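(* Let $\theta_1\le\theta_2$ be real numbers with $|\theta_j|\le\pi/2$ for $j=1,2$. Then there exist a (non-elliptic) semigroup $(\phi_t)_{t\ge 0}$ of holomorphic self-mappings of the unit disk $\mathbb{D}$ and a point $z\in\mathbb{D}$ such that the $\alpha$-limit of the extended trajectory $\gamma_z$ is a super-repulsive fixed point of $(\phi_t)$ and $$\mathrm{Slope}^-(\gamma_z)=[\theta_1,\theta_2].$$
   Context: A (one-parameter continuous) semigroup of holomorphic functions is a family $(\phi_t)_{t\in[0,\infty)}$ of holomorphic maps $\phi_t:\mathbb{D}\to\mathbb{D}$, where $\mathbb{D}$ is the open unit disk in $\mathbb{C}$, such that (i) $\phi_{t+s}=\phi_t\circ\phi_s$ for all $t,s\ge 0$; (ii) $\phi_0(z)=z$ for all $z\in\mathbb{D}$; (iii) $\lim_{t\to s}\phi_t(z)=\phi_s(z)$ for all $s\ge 0$ and $z\in\mathbb{D}$. It is non-elliptic if it has no fixed point in $\mathbb{D}$ (all semigroups considered are non-elliptic). For a non-elliptic semigroup there is a conformal (biholomorphic) map $h:\mathbb{D}\to\Omega$ onto a planar domain $\Omega=h(\mathbb{D})$ with $h(\phi_t(z))=h(z)+t$ for all $z\in\mathbb{D}$, $t\ge 0$ (the Koenigs function, and the associated planar domain). For $z\in\mathbb{D}$ let $T=\inf\{t\in\mathbb{R}: h(z)+t\in\Omega\}\in[-\infty,0)$; the extended trajectory of $z$ is the curve $\gamma_z:(T,+\infty)\to\mathbb{D}$, $\gamma_z(t)=h^{-1}(h(z)+t)$. For a curve $\Gamma:(s_1,s_2)\to\mathbb{C}$,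 the $\alpha$-limit set $\alpha(\Gamma)$ is the set of all points $p$ for which there is a strictly decreasing sequence $t_n\to s_1$ with $\Gamma(t_n)\to p$. It is known that $\alpha(\gamma_z)$ is always a single point $\chi\in\partial\mathbb{D}$, called the $\alpha$-limit of $\gamma_z$. $\mathrm{Slope}^-(\gamma_z)$ is the $\alpha$-limit set of the curve $t\in(T,+\infty)\mapsto\arg(1-\overline{\chi}\,\gamma_z(t))\in(-\pi/2,\pi/2)$, i.e. the set of all $\theta\in\mathbb{R}$ for which there is a strictly decreasing sequence $t_n\to T$ with $\arg(1-\overline{\chi}\,\gamma_z(t_n))\to\theta$. Write $\angle\lim_{z\to w}$ for the angular (non-tangential) limit at $w\in\partial\mathbb{D}$. A point $w\in\partial\mathbb{D}$ is a boundary fixed point of a holomorphic $\phi:\mathbb{D}\to\mathbb{D}$ if $\angle\lim_{z\to w}\phi(z)=w$; then the angular derivative $\phi'(w)=\angle\lim_{z\to w}\frac{w-\phi(z)}{w-z}$ exists in $(0,+\infty)\cup\{\infty\}$. The boundary fixed point $w$ is super-repulsive if $\phi'(w)=\infty$. A super-repulsive fixed point of the semigroup $(\phi_t)$ is a point of $\partial\mathbb{D}$ that is a super-repulsive boundary fixed point of $\phi_t$ for all $t>0$. *)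

theory Defs
  imports "HOL-Complex_Analysis.Complex_Analysis"
begin

abbreviation unit_disk :: "complex set" ("\<bbbD>")
  where "\<bbbD> \<equiv> ball 0 1"

text \<open>
  The maps of a family are total functions, but only the values \<open>\<phi> t z\<close> with \<open>t \<ge> 0\<close> and
  \<open>z \<in> \<bbbD>\<close> matter.
\<close>

definition holomorphic_semigroup :: "(real \<Rightarrow> complex \<Rightarrow> complex) \<Rightarrow> bool"
  where "holomorphic_semigroup \<phi> \<longleftrightarrow>
    (\<forall>t\<ge>0. \<phi> t holomorphic_on \<bbbD> \<and> \<phi> t ` \<bbbD> \<subseteq> \<bbbD>) \<and>
    (\<forall>t\<ge>0. \<forall>s\<ge>0. \<forall>z\<in>\<bbbD>. \<phi> (t + s) z = \<phi> t (\<phi> s z)) \<and>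
    (\<forall>z\<in>\<bbbD>. \<phi> 0 z = z) \<and>
    (\<forall>s\<ge>0. \<forall>z\<in>\<bbbD>. ((\<lambda>t. \<phi> t z) \<longlongrightarrow> \<phi> s z) (at s within {0..}))"

text \<open>
  No \<open>\<phi> t\<close> with \<open>t > 0\<close> has a fixed point in the disk.  For semigroups this is the same as having
  no common fixed point: if \<open>\<phi> t\<close> is not the identity, its fixed point in \<open>\<bbbD>\<close> is unique and hence
  fixed by all maps commuting with it; if \<open>\<phi> t\<close> is the identity, the semigroup is a periodic group of
  automorphisms of the disk and has a common fixed point.
\<close>

definition non_elliptic :: "(real \<Rightarrow> complex \<Rightarrow> complex) \<Rightarrow> bool"
  where "non_elliptic \<phi> \<longleftrightarrow> (\<forall>t>0. \<forall>z\<in>\<bbbD>. \<phi> t z \<noteq> z)"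

text \<open>
  The associated planar domain is \<open>h ` \<bbbD>\<close>.  A Koenigs function of a semigroup is unique up to an
  additive constant, so the notions derived from it below depend only on the semigroup: two Koenigs
  functions differ by a univalent map that commutes with translations by \<open>t \<ge> 0\<close>, hence extends to
  the connected union of the domains \<open>h ` \<bbbD> - t\<close> as a map commuting with all real translations,
  and such a map is a translation.
\<close>

definition koenigs_function :: "(real \<Rightarrow> complex \<Rightarrow> complex) \<Rightarrow> (complex \<Rightarrow> complex) \<Rightarrow> bool"
  where "koenigs_function \<phi> h \<longleftrightarrow>
    h holomorphic_on \<bbbD> \<and> inj_on h \<bbbD> \<and>
    (\<forall>t\<ge>0. \<forall>z\<in>\<bbbD>. h (\<phi> t z) = h z + of_real t)"

definition trajectory_start :: "(complex \<Rightarrow> complex) \<Rightarrow> complex \<Rightarrow> ereal"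
  where "trajectory_start h z = Inf (ereal ` {t. h z + of_real t \<in> h ` \<bbbD>})"

text \<open>Only meaningful for \<open>t\<close> with \<open>trajectory_start h z < ereal t\<close>.\<close>

definition extended_trajectory :: "(complex \<Rightarrow> complex) \<Rightarrow> complex \<Rightarrow> real \<Rightarrow> complex"
  where "extended_trajectory h z t = inv_into \<bbbD> h (h z + of_real t)"

text \<open>The curve \<open>\<Gamma>\<close> is defined on the open interval from \<open>a\<close> to \<open>b\<close>.\<close>

definition alpha_limit_set :: "ereal \<Rightarrow> ereal \<Rightarrow> (real \<Rightarrow> 'a::topological_space) \<Rightarrow> 'a set"
  where "alpha_limit_set a b \<Gamma> =
    {p. \<exists>t :: nat \<Rightarrow> real. strict_antimono_on UNIV t \<and>
          (\<forall>n. a < ereal (t n) \<and> ereal (t n) < b) \<and>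
          (\<lambda>n. ereal (t n)) \<longlonglongrightarrow> a \<and> (\<lambda>n. \<Gamma> (t n)) \<longlonglongrightarrow> p}"

definition trajectory_alpha_limit_set :: "(complex \<Rightarrow> complex) \<Rightarrow> complex \<Rightarrow> complex set"
  where "trajectory_alpha_limit_set h z =
    alpha_limit_set (trajectory_start h z) \<infinity> (extended_trajectory h z)"

text \<open>
  Here \<open>\<sigma>\<close> is the \<open>\<alpha>\<close>-limit of the trajectory.  The argument of \<open>Arg\<close> has positive real part, so
  its values lie strictly between \<open>- pi / 2\<close> and \<open>pi / 2\<close>.
\<close>

definition slope_minus :: "(complex \<Rightarrow> complex) \<Rightarrow> complex \<Rightarrow> complex \<Rightarrow> real set"
  where "slope_minus h z \<sigma> =
    alpha_limit_set (trajectory_start h z) \<infinity>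
      (\<lambda>t. Arg (1 - cnj \<sigma> * extended_trajectory h z t))"

definition stolz_region :: "complex \<Rightarrow> real \<Rightarrow> complex set"
  where "stolz_region w M = {z \<in> \<bbbD>. cmod (w - z) < M * (1 - cmod z)}"

text \<open>
  The target filter \<open>F\<close> is \<open>nhds l\<close> for a finite angular limit \<open>l\<close> and \<open>at_infinity\<close> for the
  angular limit \<open>\<infinity>\<close>.
\<close>

definition angular_lim :: "(complex \<Rightarrow> complex) \<Rightarrow> complex \<Rightarrow> complex filter \<Rightarrow> bool"
  where "angular_lim f w F \<longleftrightarrow> (\<forall>M>1. filterlim f F (at w within stolz_region w M))"

definition boundary_fixed_point :: "(complex \<Rightarrow> complex) \<Rightarrow> complex \<Rightarrow> bool"
  where "boundary_fixed_point f w \<longleftrightarrow> w \<in> sphere 0 1 \<and> angular_lim f w (nhds w)"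

definition super_repulsive :: "(complex \<Rightarrow> complex) \<Rightarrow> complex \<Rightarrow> bool"
  where "super_repulsive f w \<longleftrightarrow>
    boundary_fixed_point f w \<and> angular_lim (\<lambda>z. (w - f z) / (w - z)) w at_infinity"

definition semigroup_super_repulsive :: "(real \<Rightarrow> complex \<Rightarrow> complex) \<Rightarrow> complex \<Rightarrow> bool"
  where "semigroup_super_repulsive \<phi> w \<longleftrightarrow> (\<forall>t>0. super_repulsive (\<phi> t) w)"

end

theory Submission
  imports Defs "HOL-Real_Asymp.Real_Asymp"
begin

text \<open>
  The Cayley transform \<open>w = (1 - z) / (1 + z)\<close> turns the disk into the right half-plane and the
  boundary point \<open>1\<close> into the origin.  There the Koenigs function is given explicitly as

    \<open>h w = (\<Sum>k. c k * (Ln (w + \<epsilon> k) - \<i> * a k))\<close>,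
    \<open>c k = 1 / fact k\<close>, \<open>\<epsilon> k = exp (- fact k) * cis (a k)\<close>,

  where the angles \<open>a k\<close> lie strictly between \<open>- pi / 2\<close> and \<open>pi / 2\<close>, converge to \<open>\<theta>1\<close> along the
  even indices and to \<open>\<theta>2\<close> along the odd ones.

  The difference quotients of \<open>h\<close> have positive real part, because those of the logarithm do.  So
  \<open>h\<close> is univalent, and whenever \<open>h\<close> increases by a positive number, the point \<open>w\<close> moves to the
  right.  Together with properness (\<open>log_series_proper\<close>) this shows that the image of \<open>h\<close> is mapped
  into itself by translations to the right (\<open>log_series_translation\<close>), which gives the semigroup.
  On the imaginary axis every summand of \<open>Im h\<close> has the sign of \<open>Im w\<close>; hence \<open>h\<close> has no real
  boundary values and its image contains the whole real line (\<open>real_line_in_image\<close>).  As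
  \<open>c k * ln (cmod (\<epsilon> k)) = -1\<close>, the real part of \<open>h\<close> tends to \<open>-\<infinity>\<close> at the origin, and it does so at
  no other boundary point.  The trajectory over the real line therefore starts at the origin, and
  the origin is a boundary fixed point.  It is super-repulsive since in a sector \<open>h\<close> varies by
  arbitrarily little between points of comparable modulus near the origin
  (\<open>log_series_increment_small\<close>).

  The trajectory is the curve \<open>Im h = 0\<close>, where the sum of all \<open>c k * (Arg (w + \<epsilon> k) - a k)\<close> vanishes.
  For \<open>cmod w = cmod (\<epsilon> n)\<close> the summands before \<open>n\<close> are tiny because \<open>w\<close> is much shorter than their
  \<open>\<epsilon> k\<close>, and those after \<open>n\<close> are tiny because of their weights \<open>c k\<close>.  So the argument of \<open>w\<close> has to
  be close to \<open>a n\<close> (\<open>Im_log_series_pos_on_circle\<close>), and it comes close to \<open>\<theta>1\<close> and to \<open>\<theta>2\<close> again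
  and again.  It cannot leave the interval from \<open>\<theta>1\<close> to \<open>\<theta>2\<close> by a fixed amount near the origin,
  since then all but finitely many summands would have the same sign and outweigh the others
  (\<open>Im_log_series_pos_near_0\<close>).  By continuity the argument also comes close to every value in
  between.
\<close>

section \<open>Arguments and logarithms in the right half-plane\<close>

abbreviation right_half_plane :: "complex set"
  where "right_half_plane \<equiv> {w. 0 < Re w}"

abbreviation punctured_closed_half_plane :: "complex set"
  where "punctured_closed_half_plane \<equiv> {w. 0 \<le> Re w \<and> w \<noteq> 0}"

lemma Arg_bound_closed_half_plane:
  assumes "0 \<le> Re w" "w \<noteq> 0"
  shows "\<bar>Arg w\<bar> \<le> pi / 2"
  using assms Re_Ln_pos_le[of w] by (simp add: Arg_eq_Im_Ln)

lemma Arg_bound_half_plane: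
  assumes "0 < Re w"
  shows "\<bar>Arg w\<bar> < pi / 2"
proof -
  have "w \<noteq> 0" using assms by auto
  then show ?thesis using assms Re_Ln_pos_lt[of w] by (simp add: Arg_eq_Im_Ln)
qed

lemma Im_rotate_eq_sin:
  "Im (w * cis (- m)) = cmod w * sin (Arg w - m)"
proof -
  have "w * cis (- m) = rcis (cmod w) (Arg w) * cis (- m)"
    by (simp add: rcis_cmod_Arg)
  also have "\<dots> = rcis (cmod w) (Arg w - m)"
    by (simp add: rcis_def mult.assoc cis_mult)
  finally show ?thesis by simp
qed

text \<open>
  Bounds on the argument become linear inequalities in this way, and so they survive the addition
  of points.
\<close>

lemma Arg_ge_iff:
  assumes "0 \<le> Re w" "w \<noteq> 0" "\<bar>m\<bar> < pi / 2"
  shows "m \<le> Arg w \<longleftrightarrow> 0 \<le> Im (w * cis (- m))"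
proof -
  have b: "- pi < Arg w - m" "Arg w - m < pi"
    using Arg_bound_closed_half_plane[OF assms(1,2)] assms(3) by linarith+
  have n: "0 < cmod w" using assms by simp
  show ?thesis
  proof
    assume "m \<le> Arg w"
    then have "0 \<le> sin (Arg w - m)" using b by (intro sin_ge_zero) auto
    then show "0 \<le> Im (w * cis (- m))" unfolding Im_rotate_eq_sin by simp
  next
    assume *: "0 \<le> Im (w * cis (- m))"
    show "m \<le> Arg w"
    proof (rule ccontr)
      assume "\<not> m \<le> Arg w"
      then have "0 < sin (m - Arg w)" using b by (intro sin_gt_zero) auto
      then have "sin (Arg w - m) < 0" by (metis minus_diff_eq neg_0_less_iff_less sin_minus)
      then show False using * n unfolding Im_rotate_eq_sin by (simp add: zero_le_mult_iff)
    qed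
  qed
qed

lemma Arg_add_ge:
  assumes "0 \<le> Re w" "w \<noteq> 0" "0 < Re e" "\<bar>m\<bar> < pi / 2" "m \<le> Arg w" "m \<le> Arg e"
  shows "m \<le> Arg (w + e)"
proof -
  have "e \<noteq> 0" "w + e \<noteq> 0" using assms(1,3) by (auto simp: complex_eq_iff)
  then show ?thesis
    using assms Arg_ge_iff[of w m] Arg_ge_iff[of e m] Arg_ge_iff[of "w + e" m]
    by (auto simp: distrib_right)
qed

text \<open>
  If the summand with the larger argument is also the longer one, the argument of the sum lies
  beyond the bisector.
\<close>

lemma Arg_add_ge_midpoint:
  assumes "0 < Re w" "0 < Re e" "Arg e \<le> Arg w" "cmod e \<le> cmod w"
  shows "(Arg w + Arg e) / 2 \<le> Arg (w + e)"
proof -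
  define m where "m = (Arg w + Arg e) / 2"
  have bw: "\<bar>Arg w\<bar> < pi / 2" "\<bar>Arg e\<bar> < pi / 2"
    using assms Arg_bound_half_plane by auto
  then have "- pi < Arg w + Arg e" "Arg w + Arg e < pi" by linarith+
  moreover have "2 * m = Arg w + Arg e" by (simp add: m_def)
  ultimately have m: "\<bar>m\<bar> < pi / 2" unfolding abs_less_iff by linarith
  have d: "Arg e - m = - (Arg w - m)" by (simp add: m_def field_simps)
  have "0 \<le> sin (Arg w - m)"
    using assms(3) bw by (intro sin_ge_zero) (auto simp: m_def field_simps)
  then have "0 \<le> (cmod w - cmod e) * sin (Arg w - m)" using assms(4) by simp
  also have "\<dots> = Im ((w + e) * cis (- m))"
    unfolding distrib_right plus_complex.sel Im_rotate_eq_sin d sin_minus by (simp add: algebra_simps)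
  finally have "0 \<le> Im ((w + e) * cis (- m))" .
  moreover have "0 < Re (w + e)" using assms by simp
  moreover from this have "w + e \<noteq> 0" by (metis less_irrefl zero_complex.sel(1))
  ultimately show ?thesis using Arg_ge_iff[of "w + e" m] m unfolding m_def by simp
qed

lemma Arg_add_gt:
  assumes "0 \<le> Re w" "w \<noteq> 0" "0 < Re e" "Arg e < Arg w"
  shows "Arg e < Arg (w + e)"
proof -
  define m where "m = Arg e"
  have m: "\<bar>m\<bar> < pi / 2" using assms(3) Arg_bound_half_plane m_def by auto
  have b: "Arg w - m < pi"
    using Arg_bound_closed_half_plane[OF assms(1,2)] m by linarith
  have "0 < sin (Arg w - m)"
    using assms(4) b by (intro sin_gt_zero) (auto simp: m_def)
  then have *: "0 < Im ((w + e) * cis (- m))"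
    using assms(2) unfolding distrib_right plus_complex.sel Im_rotate_eq_sin
    by (simp add: m_def)
  have "0 < Re (w + e)" using assms by simp
  moreover from this have nz: "w + e \<noteq> 0" by (metis less_irrefl zero_complex.sel(1))
  ultimately have "m \<le> Arg (w + e)" using * m Arg_ge_iff[of "w + e" m] by simp
  moreover have "Arg (w + e) \<noteq> m" using * unfolding Im_rotate_eq_sin by auto
  ultimately show ?thesis by (simp add: m_def)
qed

lemma half_plane_not_nonpos: "0 < Re w \<Longrightarrow> w \<notin> \<real>\<^sub>\<le>\<^sub>0"
  by (auto simp: complex_nonpos_Reals_iff)

text \<open>The derivative of the logarithm at \<open>u\<close> is \<open>1 / u\<close>.\<close>

lemma cmod_Ln_diff_le:
  assumes S: "convex S" "\<And>u. u \<in> S \<Longrightarrow> 0 < Re u \<and> d \<le> cmod u" and d: "0 < d"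
    and xy: "x \<in> S" "y \<in> S"
  shows "cmod (Ln x - Ln y) \<le> cmod (x - y) / d"
proof -
  have "cmod (Ln x - Ln y) \<le> (1 / d) * cmod (x - y)"
  proof (rule field_differentiable_bound[OF S(1) _ _ xy])
    fix u assume u: "u \<in> S"
    show "(Ln has_field_derivative (1 / u)) (at u within S)"
      using S(2)[OF u] half_plane_not_nonpos
      by (auto intro!: derivative_eq_intros simp: field_simps)
    show "cmod (1 / u) \<le> 1 / d"
      using S(2)[OF u] d by (simp add: norm_divide frac_le)
  qed
  then show ?thesis by simp
qed

text \<open>
  The derivative of the logarithm has positive real part on the half-plane.  Positivity of the
  difference quotient is inherited by positive combinations of translates, without any
  differentiation of a series.
\<close>

lemma Re_Ln_diff_quotient_pos:
  assumes "0 < Re x" "0 < Re y" "x \<noteq> y"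
  shows "0 < Re ((Ln y - Ln x) / (y - x))"
proof -
  define p where "p t = x + of_real t * (y - x)" for t :: real
  have pos: "0 < Re (p t)" if "0 \<le> t" "t \<le> 1" for t
  proof -
    have "Re (p t) = (1 - t) * Re x + t * Re y" by (simp add: p_def algebra_simps)
    then show ?thesis using that assms
      by (cases "t = 0") (auto intro!: add_nonneg_pos mult_nonneg_nonneg)
  qed
  have "\<exists>t>0. t < 1 \<and> Re (Ln (p 1) / (y - x)) - Re (Ln (p 0) / (y - x)) = (1 - 0) * Re (1 / p t)"
  proof (rule MVT2)
    fix t :: real assume t: "0 \<le> t" "t \<le> 1"
    have "((\<lambda>t. Ln (p t) / (y - x)) has_vector_derivative 1 / p t) (at t)"
    proof -
      have "(p has_vector_derivative (y - x)) (at t)"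
        unfolding p_def by (auto intro!: derivative_eq_intros)
      moreover have "(Ln has_field_derivative 1 / p t) (at (p t))"
        using half_plane_not_nonpos[OF pos[OF t]]
        by (auto intro!: derivative_eq_intros simp: field_simps)
      ultimately have "((Ln \<circ> p) has_vector_derivative (y - x) * (1 / p t)) (at t)"
        by (rule field_vector_diff_chain_at)
      then have "((\<lambda>t. (Ln \<circ> p) t / (y - x)) has_vector_derivative ((y - x) * (1 / p t)) / (y - x)) (at t)"
        by (rule has_vector_derivative_divide)
      then show ?thesis using assms by (simp add: o_def)
    qed
    then show "((\<lambda>t. Re (Ln (p t) / (y - x))) has_real_derivative Re (1 / p t)) (at t)"
      by (rule has_field_derivative_Re)
  qed simp
  then obtain t where t: "0 < t" "t < 1"
    "Re (Ln (p 1) / (y - x)) - Re (Ln (p 0) / (y - x)) = Re (1 / p t)" by auto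
  have "0 < Re (1 / p t)"
  proof -
    have "0 < Re (p t)" using t pos by simp
    moreover from this have "p t \<noteq> 0" by auto
    ultimately show ?thesis by (simp add: Re_divide sum_power2_gt_zero_iff complex_eq_iff)
  qed
  then show ?thesis using t(3) by (simp add: p_def diff_divide_distrib)
qed

section \<open>Weights and radii\<close>

text \<open>
  Each weight dominates the sum of all later ones.  The radii are fixed by
  \<open>weight k * ln (radius k) = -1\<close>: this makes the logarithmic series below diverge at the origin,
  and still the radii decay so fast that \<open>radius n\<close> and \<open>radius (Suc n) / radius n\<close> are negligible
  against \<open>weight (Suc n)\<close>.
\<close>

definition weight :: "nat \<Rightarrow> real"
  where "weight k = 1 / fact k"

definition radius :: "nat \<Rightarrow> real"
  where "radius k = exp (- fact k)"

lemma weight_pos: "0 < weight k" by (simp add: weight_def)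

lemma radius_pos: "0 < radius k" by (simp add: radius_def)

lemma radius_antimono: "m \<le> n \<Longrightarrow> radius n \<le> radius m"
  by (simp add: radius_def fact_mono)

lemma radius_le_half: "radius k \<le> 1 / 2"
proof -
  have "radius k \<le> exp (- 1)" by (simp add: radius_def)
  also have "\<dots> \<le> 1 / 2"
    using exp_ge_add_one_self[of 1] by (simp add: exp_minus field_simps)
  finally show ?thesis .
qed

lemma weight_summable: "summable weight"
  using summable_exp[of "1::real"] by (simp add: weight_def[abs_def] divide_inverse)

lemma filterlim_fact_real: "filterlim (\<lambda>n. fact n :: real) at_top sequentially"
proof (rule filterlim_at_top_mono[OF filterlim_real_sequentially])
  show "\<forall>\<^sub>F n in sequentially. real n \<le> fact n"
    by (intro always_eventually allI) (metis fact_ge_self of_nat_fact of_nat_mono)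
qed

lemma radius_tendsto_0: "radius \<longlonglongrightarrow> 0"
  unfolding radius_def[abs_def]
  by (rule filterlim_compose[OF exp_at_bot])
     (rule filterlim_compose[OF filterlim_uminus_at_bot_at_top filterlim_fact_real])

lemma weight_ln_radius: "weight k * ln (radius k) = - 1"
  by (simp add: weight_def radius_def)

lemma weight_tail: "(\<Sum>j. weight (j + Suc n)) \<le> 2 * weight (Suc n)"
proof -
  have le: "weight (j + Suc n) \<le> weight (Suc n) * (1 / 2) ^ j" for j
  proof (induction j)
    case (Suc j)
    have "weight (Suc j + Suc n) = weight (j + Suc n) / real (Suc (j + Suc n))"
      by (simp add: weight_def)
    also have "\<dots> \<le> weight (j + Suc n) / 2"
      by (intro divide_left_mono) (auto simp: weight_pos less_imp_le)
    also have "\<dots> \<le> weight (Suc n) * (1 / 2) ^ Suc j" using Suc by simp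
    finally show ?case .
  qed simp
  have "(\<Sum>j. weight (j + Suc n)) \<le> (\<Sum>j. weight (Suc n) * (1 / 2) ^ j)"
    by (intro suminf_le le summable_mult summable_geometric summable_ignore_initial_segment
        weight_summable) auto
  also have "\<dots> = 2 * weight (Suc n)"
    by (subst suminf_mult) (auto simp: summable_geometric suminf_geometric)
  finally show ?thesis .
qed

lemma weight_tail_ratio: "(\<lambda>n. (\<Sum>j. weight (j + Suc n)) / weight n) \<longlonglongrightarrow> 0"
proof (rule tendsto_sandwich[OF _ _ tendsto_const])
  show "(\<lambda>n. 2 / real (Suc n)) \<longlonglongrightarrow> 0" by real_asymp
  show "\<forall>\<^sub>F n in sequentially. 0 \<le> (\<Sum>j. weight (j + Suc n)) / weight n"
    by (intro always_eventually allI divide_nonneg_pos suminf_nonneg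
        summable_ignore_initial_segment weight_summable weight_pos less_imp_le[OF weight_pos])
  have "(\<Sum>j. weight (j + Suc n)) / weight n \<le> 2 / real (Suc n)" for n
  proof -
    have "(\<Sum>j. weight (j + Suc n)) / weight n \<le> 2 * weight (Suc n) / weight n"
      by (intro divide_right_mono weight_tail less_imp_le[OF weight_pos])
    also have "\<dots> = 2 / real (Suc n)" by (simp add: weight_def)
    finally show ?thesis .
  qed
  then show "\<forall>\<^sub>F n in sequentially. (\<Sum>j. weight (j + Suc n)) / weight n \<le> 2 / real (Suc n)"
    by simp
qed

lemma radius_over_next_weight: "(\<lambda>n. radius n / weight (Suc n)) \<longlonglongrightarrow> 0"
proof (rule tendsto_sandwich[OF _ _ tendsto_const])
  have *: "((\<lambda>x::real. (x + 1) * x * exp (- x)) \<longlongrightarrow> 0) at_top" by real_asymp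
  show "(\<lambda>n. (fact n + 1) * fact n * exp (- fact n) :: real) \<longlonglongrightarrow> 0"
    using filterlim_compose[OF * filterlim_fact_real] by simp
  show "\<forall>\<^sub>F n in sequentially. 0 \<le> radius n / weight (Suc n)"
    by (simp add: less_imp_le radius_pos weight_pos)
  have "radius n / weight (Suc n) \<le> (fact n + 1) * fact n * exp (- fact n)" for n
  proof -
    have "real n \<le> fact n" by (metis fact_ge_self of_nat_fact of_nat_mono)
    then have "(1 + real n) * fact n * exp (- fact n) \<le> (fact n + 1) * fact n * exp (- fact n)"
      by (intro mult_right_mono) auto
    then show ?thesis by (simp add: radius_def weight_def mult_ac)
  qed
  then show "\<forall>\<^sub>F n in sequentially. radius n / weight (Suc n) \<le> (fact n + 1) * fact n * exp (- fact n)"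
    by simp
qed

lemma radius_ratio_over_weight: "(\<lambda>n. radius (Suc n) / radius n / weight (Suc n)) \<longlonglongrightarrow> 0"
proof (rule tendsto_sandwich[OF _ _ tendsto_const])
  have *: "((\<lambda>x::real. x * exp (- (x / 2))) \<longlongrightarrow> 0) at_top" by real_asymp
  show "(\<lambda>n. fact (Suc n) * exp (- (fact (Suc n) / 2)) :: real) \<longlonglongrightarrow> 0"
    using filterlim_compose[OF * filterlim_compose[OF filterlim_fact_real filterlim_Suc]] by simp
  show "\<forall>\<^sub>F n in sequentially. 0 \<le> radius (Suc n) / radius n / weight (Suc n)"
    by (simp add: less_imp_le radius_pos weight_pos)
  have "radius (Suc n) / radius n / weight (Suc n) \<le> fact (Suc n) * exp (- (fact (Suc n) / 2))"
    if "1 \<le> n" for n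
  proof -
    have "2 * fact n \<le> real (Suc n) * fact n" using that by (intro mult_right_mono) auto
    then have "2 * fact n \<le> (fact (Suc n) :: real)" by simp
    then have "- fact (Suc n) + fact n \<le> - (fact (Suc n) / 2 :: real)" by linarith
    then have "exp (- fact (Suc n) + fact n :: real) \<le> exp (- (fact (Suc n) / 2))"
      by (simp only: exp_le_cancel_iff)
    moreover have "radius (Suc n) / radius n = exp (- fact (Suc n) + fact n)"
      unfolding radius_def exp_diff[symmetric] by (simp del: fact_Suc)
    then have "radius (Suc n) / radius n / weight (Suc n)
        = fact (Suc n) * exp (- fact (Suc n) + fact n)"
      by (simp add: weight_def del: fact_Suc)
    ultimately show ?thesis by (simp del: fact_Suc)
  qed
  then show "\<forall>\<^sub>F n in sequentially. radius (Suc n) / radius n / weight (Suc n)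
      \<le> fact (Suc n) * exp (- (fact (Suc n) / 2))"
    by (rule eventually_mono[OF eventually_ge_at_top[of 1]])
qed

section \<open>A logarithmic series on the right half-plane\<close>

definition branch_offset :: "(nat \<Rightarrow> real) \<Rightarrow> nat \<Rightarrow> complex"
  where "branch_offset a k = of_real (radius k) * cis (a k)"

text \<open>
  The subtracted angle is the argument of the branch offset, so the imaginary part of every summand
  vanishes at the origin.
\<close>

definition log_term :: "(nat \<Rightarrow> real) \<Rightarrow> nat \<Rightarrow> complex \<Rightarrow> complex"
  where "log_term a k w = of_real (weight k) * (Ln (w + branch_offset a k) - \<i> * of_real (a k))"

definition log_series :: "(nat \<Rightarrow> real) \<Rightarrow> complex \<Rightarrow> complex"
  where "log_series a w = (\<Sum>k. log_term a k w)"

locale acute_angles =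
  fixes a :: "nat \<Rightarrow> real"
  assumes acute: "\<bar>a k\<bar> < pi / 2"
begin

lemma cmod_branch_offset: "cmod (branch_offset a k) = radius k"
  by (simp add: branch_offset_def norm_mult radius_pos less_imp_le)

lemma Re_branch_offset_pos: "0 < Re (branch_offset a k)"
proof -
  have "0 < cos (a k)" using acute[of k] by (intro cos_gt_zero_pi) linarith+
  then show ?thesis by (simp add: branch_offset_def radius_pos)
qed

lemma branch_offset_nonzero: "branch_offset a k \<noteq> 0"
  using Re_branch_offset_pos[of k] by auto

lemma Arg_branch_offset: "Arg (branch_offset a k) = a k"
proof -
  have "Arg (of_real (radius k) * cis (a k)) = Arg (cis (a k))"
    using radius_pos by (simp add: Arg_times_of_real)
  also have "\<dots> = a k" using acute[of k] by (intro Arg_cis) auto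
  finally show ?thesis by (simp add: branch_offset_def)
qed

lemma Re_add_branch_offset_pos: "0 \<le> Re w \<Longrightarrow> 0 < Re (w + branch_offset a k)"
  using Re_branch_offset_pos[of k] by simp

lemma add_branch_offset_nonzero: "0 \<le> Re w \<Longrightarrow> w + branch_offset a k \<noteq> 0"
  using Re_add_branch_offset_pos[of w k] by (metis less_irrefl zero_complex.sel(1))

lemma Re_log_term:
  "0 \<le> Re w \<Longrightarrow> Re (log_term a k w) = weight k * ln (cmod (w + branch_offset a k))"
  by (simp add: log_term_def add_branch_offset_nonzero)

lemma Im_log_term:
  "0 \<le> Re w \<Longrightarrow> Im (log_term a k w) = weight k * (Arg (w + branch_offset a k) - a k)"
  by (simp add: log_term_def add_branch_offset_nonzero Arg_eq_Im_Ln)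

lemma log_term_holomorphic: "log_term a k holomorphic_on right_half_plane"
  unfolding log_term_def[abs_def] using Re_add_branch_offset_pos half_plane_not_nonpos
  by (auto intro!: holomorphic_intros simp: less_imp_le)

lemma log_term_continuous: "continuous_on {w. 0 \<le> Re w} (log_term a k)"
  unfolding log_term_def[abs_def] using Re_add_branch_offset_pos half_plane_not_nonpos
  by (auto intro!: continuous_intros)

text \<open>
  The bound on the summands is available only for those \<open>k\<close> whose branch point is closer to the
  origin than the annulus; as the branch points accumulate at the origin, that is all but finitely
  many.
\<close>

lemma log_series_uniform_limit:
  assumes "0 < d"
  shows "uniform_limit {w. 0 \<le> Re w \<and> d \<le> cmod w \<and> cmod w \<le> R}
    (\<lambda>n w. \<Sum>k<n. log_term a k w) (log_series a) sequentially"
proof -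
  define B where "B = \<bar>ln (d / 2)\<bar> + \<bar>ln (\<bar>R\<bar> + 1)\<bar> + pi / 2 + pi / 2"
  have "\<forall>\<^sub>F k in sequentially. radius k < d / 2"
    by (rule order_tendstoD(2)[OF radius_tendsto_0]) (use assms in simp)
  then have "\<forall>\<^sub>F k in sequentially. \<forall>w\<in>{w. 0 \<le> Re w \<and> d \<le> cmod w \<and> cmod w \<le> R}.
      cmod (log_term a k w) \<le> weight k * B"
  proof (rule eventually_mono, safe)
    fix k w assume k: "radius k < d / 2" and w: "0 \<le> Re w" "d \<le> cmod w" "cmod w \<le> R"
    define u where "u = w + branch_offset a k"
    have u: "0 < Re u" "u \<noteq> 0" using w by (simp_all add: u_def Re_add_branch_offset_pos
          add_branch_offset_nonzero del: plus_complex.sel)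
    have "cmod w \<le> cmod u + radius k"
      using norm_triangle_ineq4[of u "branch_offset a k"] by (simp add: u_def cmod_branch_offset)
    then have lo: "d / 2 \<le> cmod u" using k w by linarith
    have "cmod u \<le> cmod w + radius k"
      using norm_triangle_ineq[of w "branch_offset a k"] by (simp add: u_def cmod_branch_offset)
    then have hi: "cmod u \<le> \<bar>R\<bar> + 1" using w radius_le_half[of k] by linarith
    have "ln (d / 2) \<le> ln (cmod u)" "ln (cmod u) \<le> ln (\<bar>R\<bar> + 1)"
      using lo hi assms u by (auto intro: ln_mono)
    then have "\<bar>Re (Ln u)\<bar> \<le> \<bar>ln (d / 2)\<bar> + \<bar>ln (\<bar>R\<bar> + 1)\<bar>"
      unfolding Re_Ln[OF u(2)] by linarith
    moreover have "\<bar>Im (Ln u)\<bar> \<le> pi / 2"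
      using Arg_bound_half_plane[OF u(1)] Arg_eq_Im_Ln[OF u(2)] by linarith
    moreover have "cmod (Ln u) \<le> \<bar>Re (Ln u)\<bar> + \<bar>Im (Ln u)\<bar>" by (rule cmod_le)
    moreover have "cmod (Ln u - \<i> * of_real (a k)) \<le> cmod (Ln u) + \<bar>a k\<bar>"
      using norm_triangle_ineq4[of "Ln u" "\<i> * of_real (a k)"] by (simp add: norm_mult)
    ultimately have "cmod (Ln u - \<i> * of_real (a k)) \<le> B"
      using acute[of k] unfolding B_def by linarith
    then show "cmod (log_term a k w) \<le> weight k * B"
      unfolding log_term_def u_def[symmetric] norm_mult norm_of_real
      using weight_pos[of k] by (intro mult_mono) auto
  qed
  then show ?thesis unfolding log_series_def[abs_def]
    by (rule Weierstrass_m_test_ev) (intro summable_mult2 weight_summable)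
qed

lemma log_series_sums:
  assumes "w \<in> punctured_closed_half_plane"
  shows "(\<lambda>k. log_term a k w) sums log_series a w"
proof -
  have "uniform_limit {u. 0 \<le> Re u \<and> cmod w \<le> cmod u \<and> cmod u \<le> cmod w}
    (\<lambda>n w. \<Sum>k<n. log_term a k w) (log_series a) sequentially"
    using assms by (intro log_series_uniform_limit) auto
  then show ?thesis unfolding sums_def
    by (rule tendsto_uniform_limitI) (use assms in auto)
qed

lemma log_series_Re_sums:
  assumes "w \<in> punctured_closed_half_plane"
  shows "(\<lambda>k. weight k * ln (cmod (w + branch_offset a k))) sums Re (log_series a w)"
  using sums_Re[OF log_series_sums[OF assms]] assms by (simp add: Re_log_term)

lemma log_series_Im_sums:
  assumes "w \<in> punctured_closed_half_plane"
  shows "(\<lambda>k. weight k * (Arg (w + branch_offset a k) - a k)) sums Im (log_series a w)"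
  using sums_Im[OF log_series_sums[OF assms]] assms by (simp add: Im_log_term)

lemma log_series_isCont:
  assumes w: "w \<in> punctured_closed_half_plane"
  shows "continuous (at w within punctured_closed_half_plane) (log_series a)"
proof -
  define A where "A = {u. 0 \<le> Re u \<and> cmod w / 2 \<le> cmod u \<and> cmod u \<le> 2 * cmod w}"
  have "continuous_on A (log_series a)"
  proof (rule uniform_limit_theorem)
    show "uniform_limit A (\<lambda>n w. \<Sum>k<n. log_term a k w) (log_series a) sequentially"
      unfolding A_def using w by (intro log_series_uniform_limit) auto
    show "\<forall>\<^sub>F n in sequentially. continuous_on A (\<lambda>w. \<Sum>k<n. log_term a k w)"
      by (intro always_eventually allI continuous_on_sum continuous_on_subset[OF log_term_continuous])
         (auto simp: A_def)
  qed simp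
  moreover have "w \<in> A" using w by (auto simp: A_def)
  ultimately have "continuous (at w within A) (log_series a)"
    by (simp add: continuous_on_eq_continuous_within)
  moreover have "at w within A = at w within punctured_closed_half_plane"
  proof (rule at_within_nhd)
    show "w \<in> {u. cmod w / 2 < cmod u \<and> cmod u < 2 * cmod w}" using w by auto
    show "open {u. cmod w / 2 < cmod u \<and> cmod u < 2 * cmod w}"
      by (intro open_Collect_conj open_Collect_less continuous_intros)
    show "A \<inter> {u. cmod w / 2 < cmod u \<and> cmod u < 2 * cmod w} - {w} =
        punctured_closed_half_plane \<inter> {u. cmod w / 2 < cmod u \<and> cmod u < 2 * cmod w} - {w}"
      using w by (auto simp: A_def)
  qed
  ultimately show ?thesis by (simp add: continuous_within)
qed

lemma log_series_continuous: "continuous_on punctured_closed_half_plane (log_series a)"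
  by (simp add: continuous_on_eq_continuous_within log_series_isCont)

lemma log_series_holomorphic: "log_series a holomorphic_on right_half_plane"
proof (rule holomorphic_uniform_sequence)
  show "open right_half_plane" by (simp add: open_halfspace_Re_gt)
  show "(\<lambda>w. \<Sum>k<n. log_term a k w) holomorphic_on right_half_plane" for n
    by (intro holomorphic_on_sum log_term_holomorphic)
  fix w :: complex assume w: "w \<in> right_half_plane"
  have sub: "cball w (Re w / 2) \<subseteq> {u. 0 < Re u \<and> Re w / 2 \<le> cmod u \<and> cmod u \<le> 2 * cmod w}"
  proof safe
    fix u assume "u \<in> cball w (Re w / 2)"
    then have d: "cmod (w - u) \<le> Re w / 2" by (simp add: dist_norm)
    then have "\<bar>Re w - Re u\<bar> \<le> Re w / 2" using abs_Re_le_cmod[of "w - u"] by simp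
    then have r: "Re w / 2 \<le> Re u" by linarith
    then show "0 < Re u" using w by simp
    show "Re w / 2 \<le> cmod u" using r complex_Re_le_cmod[of u] by linarith
    show "cmod u \<le> 2 * cmod w"
      using d norm_triangle_ineq2[of u w] complex_Re_le_cmod[of w] w norm_minus_commute[of u w]
      by simp
  qed
  show "\<exists>d>0. cball w d \<subseteq> right_half_plane \<and>
      uniform_limit (cball w d) (\<lambda>n w. \<Sum>k<n. log_term a k w) (log_series a) sequentially"
  proof (intro exI[of _ "Re w / 2"] conjI)
    show "0 < Re w / 2" using w by simp
    show "cball w (Re w / 2) \<subseteq> right_half_plane" using sub by auto
    show "uniform_limit (cball w (Re w / 2)) (\<lambda>n w. \<Sum>k<n. log_term a k w) (log_series a) sequentially"
      using w sub by (intro uniform_limit_on_subset[OF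
            log_series_uniform_limit[of "Re w / 2" "2 * cmod w"]]) auto
  qed
qed

lemma log_series_diff_quotient_pos:
  assumes "0 < Re x" "0 < Re y" "x \<noteq> y"
  shows "0 < Re ((log_series a y - log_series a x) / (y - x))"
proof -
  have K: "x \<in> punctured_closed_half_plane" "y \<in> punctured_closed_half_plane"
    using assms by auto
  define q where "q k = weight k *
    Re ((Ln (y + branch_offset a k) - Ln (x + branch_offset a k)) / (y - x))" for k
  have "(\<lambda>k. Re ((log_term a k y - log_term a k x) / (y - x))) sums
      Re ((log_series a y - log_series a x) / (y - x))"
    by (intro sums_Re sums_divide sums_diff log_series_sums K)
  moreover have "Re ((log_term a k y - log_term a k x) / (y - x)) = q k" for k
  proof -
    have "log_term a k y - log_term a k x = of_real (weight k) *
      (Ln (y + branch_offset a k) - Ln (x + branch_offset a k))"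
      by (simp add: log_term_def algebra_simps)
    then show ?thesis unfolding q_def by (simp only: times_divide_eq_right[symmetric] times_complex.sel
          Re_complex_of_real Im_complex_of_real mult_zero_left diff_zero)
  qed
  ultimately have "q sums Re ((log_series a y - log_series a x) / (y - x))" by simp
  moreover have "0 < q k" for k
  proof -
    have "0 < Re ((Ln (y + branch_offset a k) - Ln (x + branch_offset a k)) /
        ((y + branch_offset a k) - (x + branch_offset a k)))"
      using assms by (intro Re_Ln_diff_quotient_pos Re_add_branch_offset_pos) auto
    then show ?thesis by (simp add: q_def weight_pos)
  qed
  ultimately show ?thesis
    by (metis sums_unique suminf_pos sums_summable)
qed

lemma log_series_inj: "inj_on (log_series a) right_half_plane"
proof (rule inj_onI, rule ccontr)
  fix x y :: complex
  assume "x \<in> right_half_plane" "y \<in> right_half_plane" "log_series a x = log_series a y" "x \<noteq> y"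
  then show False using log_series_diff_quotient_pos[of x y] by simp
qed

text \<open>
  The real part moves to the right along the flow: the increment of the series is a positive
  number, so the increment of the variable inherits the sign of the difference quotient.
\<close>

lemma Re_mono_along_translation:
  assumes "0 < Re x" "0 < Re y" "log_series a y = log_series a x + of_real t" "0 \<le> t"
  shows "Re x \<le> Re y"
proof (cases "x = y")
  case False
  then have "0 < Re (of_real t / (y - x))"
    using log_series_diff_quotient_pos[OF assms(1,2)] assms(3) by simp
  moreover have "Re (of_real t / (y - x)) = t * Re (y - x) / (cmod (y - x))\<^sup>2"
    by (simp add: Re_divide cmod_power2)
  ultimately have "0 < t * Re (y - x)"
    using False by (simp add: zero_less_divide_iff)
  then show ?thesis using assms(4) by (simp add: zero_less_mult_iff)
qed simp

section \<open>Behaviour at the origin and at infinity\<close>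

text \<open>
  Each of the first summands contributes \<open>-1\<close> in the limit, and close to the origin no summand is
  positive.
\<close>

lemma log_series_Re_at_0:
  "filterlim (\<lambda>w. Re (log_series a w)) at_bot (at 0 within {w. 0 \<le> Re w})"
  unfolding filterlim_at_bot
proof
  fix B :: real
  obtain N :: nat where N: "- B < real N" using reals_Archimedean2 by blast
  have "((\<lambda>w. \<Sum>k<N. weight k * ln (cmod (w + branch_offset a k))) \<longlongrightarrow>
      (\<Sum>k<N. weight k * ln (cmod (0 + branch_offset a k)))) (at 0 within {w. 0 \<le> Re w})"
    by (intro tendsto_intros) (simp add: branch_offset_nonzero)
  also have "(\<Sum>k<N. weight k * ln (cmod (0 + branch_offset a k))) = - real N"
    by (simp add: cmod_branch_offset weight_ln_radius)
  finally have "\<forall>\<^sub>F w in at 0 within {w. 0 \<le> Re w}.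
      (\<Sum>k<N. weight k * ln (cmod (w + branch_offset a k))) < B"
    using N by (intro order_tendstoD(2)) auto
  moreover have "\<forall>\<^sub>F w in at 0 within {w. 0 \<le> Re w}. cmod w < 1 / 2 \<and> w \<noteq> 0 \<and> 0 \<le> Re w"
    unfolding eventually_at by (intro exI[of _ "1/2"]) (auto simp: dist_norm)
  ultimately show "\<forall>\<^sub>F w in at 0 within {w. 0 \<le> Re w}. Re (log_series a w) \<le> B"
  proof eventually_elim
    case (elim w)
    have w: "w \<in> punctured_closed_half_plane" using elim by auto
    note s = log_series_Re_sums[OF w]
    have "ln (cmod (w + branch_offset a k)) \<le> 0" for k
    proof -
      have "cmod (w + branch_offset a k) \<le> 1"
        using norm_triangle_ineq[of w "branch_offset a k"] cmod_branch_offset[of k]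
          radius_le_half[of k] elim by linarith
      moreover have "0 < cmod (w + branch_offset a k)"
        using elim add_branch_offset_nonzero by simp
      ultimately show ?thesis by simp
    qed
    then have "(\<Sum>k. weight (k + N) * ln (cmod (w + branch_offset a (k + N)))) \<le> (\<Sum>k. 0)"
      by (intro suminf_le summable_ignore_initial_segment[OF sums_summable[OF s]])
         (auto intro!: mult_nonneg_nonpos simp: weight_pos less_imp_le)
    then show ?case
      using suminf_split_initial_segment[OF sums_summable[OF s], of N] sums_unique[OF s] elim
      by simp
  qed
qed

lemma log_series_Re_ge_ln:
  assumes "0 \<le> Re w" "2 \<le> cmod w"
  shows "ln (cmod w - 1 / 2) \<le> Re (log_series a w)"
proof -
  have w: "w \<in> punctured_closed_half_plane" using assms by auto
  note s = log_series_Re_sums[OF w]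
  have lo: "cmod w - 1 / 2 \<le> cmod (w + branch_offset a k)" for k
    using norm_triangle_ineq4[of "w + branch_offset a k" "branch_offset a k"] cmod_branch_offset[of k]
      radius_le_half[of k] by simp
  have nn: "0 \<le> ln (cmod (w + branch_offset a k))" for k
    using lo[of k] assms by simp
  have "ln (cmod w - 1 / 2) \<le> ln (cmod (w + branch_offset a 0))"
    using lo[of 0] assms by (intro ln_mono) auto
  also have "\<dots> = (\<Sum>k\<in>{0}. weight k * ln (cmod (w + branch_offset a k)))"
    by (simp add: weight_def)
  also have "\<dots> \<le> Re (log_series a w)"
    unfolding sums_unique[OF s] using nn
    by (intro sum_le_suminf sums_summable[OF s]) (auto simp: weight_pos less_imp_le)
  finally show ?thesis .
qed

lemma cmod_le_of_log_series_Re_le: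
  assumes "0 \<le> Re w" "Re (log_series a w) \<le> B"
  shows "cmod w \<le> exp B + 2"
proof (cases "2 \<le> cmod w")
  case True
  then have "ln (cmod w - 1 / 2) \<le> B" using log_series_Re_ge_ln assms by force
  moreover have "0 < cmod w - 1 / 2" using True by linarith
  ultimately have "cmod w - 1 / 2 \<le> exp B" by (metis exp_le_cancel_iff exp_ln)
  then show ?thesis by simp
next
  case False
  then show ?thesis using exp_ge_zero[of B] by linarith
qed

text \<open>
  Properness of the series on the closed half-plane without the origin: preimages of bounded
  sequences stay away from the origin and from infinity.
\<close>

lemma log_series_proper:
  assumes w: "\<And>n. w n \<in> punctured_closed_half_plane" and lim: "(\<lambda>n. log_series a (w n)) \<longlonglongrightarrow> y"
  obtains l r where "l \<in> punctured_closed_half_plane" "strict_mono r" "(w \<circ> r) \<longlonglongrightarrow> l"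
    "log_series a l = y"
proof -
  have "Bseq (\<lambda>n. log_series a (w n))" using lim convergentI convergent_imp_Bseq by blast
  then obtain B where "\<And>n. cmod (log_series a (w n)) \<le> B" unfolding Bseq_def by auto
  then have B: "\<bar>Re (log_series a (w n))\<bar> \<le> B" for n
    using abs_Re_le_cmod order_trans by blast
  have "cmod (w n) \<le> exp B + 2" for n
    using w B[of n] by (intro cmod_le_of_log_series_Re_le) auto
  then have "bounded (range w)" by (auto simp: bounded_iff)
  then obtain l r where r: "strict_mono r" "(w \<circ> r) \<longlonglongrightarrow> l"
    using bounded_imp_convergent_subsequence by blast
  have nn: "0 \<le> Re l"
  proof (rule LIMSEQ_le_const)
    show "(\<lambda>n. Re ((w \<circ> r) n)) \<longlonglongrightarrow> Re l" using r(2) by (rule tendsto_Re)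
    show "\<exists>N. \<forall>n\<ge>N. 0 \<le> Re ((w \<circ> r) n)" using w by auto
  qed
  have "l \<noteq> 0"
  proof
    assume "l = 0"
    then have "filterlim (w \<circ> r) (at 0 within {w. 0 \<le> Re w}) sequentially"
      using r(2) w by (auto simp: filterlim_at)
    from filterlim_compose[OF log_series_Re_at_0 this]
    have "\<forall>\<^sub>F n in sequentially. Re (log_series a ((w \<circ> r) n)) \<le> - B - 1"
      unfolding filterlim_at_bot by blast
    then obtain n where "Re (log_series a ((w \<circ> r) n)) \<le> - B - 1"
      unfolding eventually_sequentially by auto
    then show False using B[of "r n"] by simp
  qed
  then have l: "l \<in> punctured_closed_half_plane" using nn by simp
  have "(\<lambda>n. log_series a ((w \<circ> r) n)) \<longlonglongrightarrow> log_series a l"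
    using continuous_on_tendsto_compose[OF log_series_continuous r(2) l] w by auto
  moreover have "(\<lambda>n. log_series a ((w \<circ> r) n)) \<longlonglongrightarrow> y"
    using LIMSEQ_subseq_LIMSEQ[OF lim r(1)] by (simp add: o_def)
  ultimately have "log_series a l = y" by (rule LIMSEQ_unique)
  then show ?thesis using that l r by blast
qed

lemma log_series_Re_bounded_below:
  assumes "0 < d"
  obtains B where "\<And>w. 0 \<le> Re w \<Longrightarrow> d \<le> cmod w \<Longrightarrow> B \<le> Re (log_series a w)"
proof -
  define A where "A = {w. 0 \<le> Re w} \<inter> {w. d \<le> cmod w} \<inter> cball 0 2"
  have "closed {w::complex. d \<le> cmod w}" by (intro closed_Collect_le continuous_intros)
  then have "compact A" unfolding A_def
    by (intro closed_Int_compact closed_Int) (auto simp: closed_halfspace_Re_ge)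
  moreover have "continuous_on A (log_series a)"
    using assms by (intro continuous_on_subset[OF log_series_continuous]) (auto simp: A_def)
  ultimately have "bounded (log_series a ` A)"
    by (intro compact_imp_bounded compact_continuous_image)
  then obtain B where "\<forall>y\<in>log_series a ` A. cmod y \<le> B" unfolding bounded_iff ..
  then have B: "cmod (log_series a w) \<le> B" if "w \<in> A" for w using that by blast
  have "- \<bar>B\<bar> \<le> Re (log_series a w)" if "0 \<le> Re w" "d \<le> cmod w" for w
  proof (cases "cmod w \<le> 2")
    case True
    then have "cmod (log_series a w) \<le> B" using that by (intro B) (auto simp: A_def)
    then show ?thesis using abs_Re_le_cmod[of "log_series a w"] by linarith
  next
    case False
    then have "0 \<le> ln (cmod w - 1 / 2)" by simp
    moreover have "ln (cmod w - 1 / 2) \<le> Re (log_series a w)"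
      using log_series_Re_ge_ln[of w] that False by simp
    ultimately show ?thesis by linarith
  qed
  then show ?thesis using that by blast
qed

end

context acute_angles
begin

section \<open>Horizontal translations of the image domain\<close>

lemma acute_angles_uminus: "acute_angles (\<lambda>k. - a k)"
  by unfold_locales (use acute in simp)

text \<open>Complex conjugation reduces every lower bound on the argument to an upper bound.\<close>

lemma log_series_cnj:
  assumes "w \<in> punctured_closed_half_plane"
  shows "log_series (\<lambda>k. - a k) (cnj w) = cnj (log_series a w)"
proof -
  have "log_term (\<lambda>k. - a k) k (cnj w) = cnj (log_term a k w)" for k
  proof -
    have "w + branch_offset a k \<notin> \<real>\<^sub>\<le>\<^sub>0"
      using assms by (intro half_plane_not_nonpos Re_add_branch_offset_pos) auto
    then have "Ln (cnj (w + branch_offset a k)) = cnj (Ln (w + branch_offset a k))"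
      by (rule cnj_Ln[symmetric])
    moreover have "branch_offset (\<lambda>k. - a k) k = cnj (branch_offset a k)"
      by (simp add: branch_offset_def cis_cnj)
    ultimately show ?thesis by (simp add: log_term_def)
  qed
  moreover have "(\<lambda>k. cnj (log_term a k w)) sums cnj (log_series a w)"
    using log_series_sums[OF assms] by (simp add: sums_cnj)
  ultimately show ?thesis unfolding log_series_def by (simp add: sums_iff)
qed

text \<open>
  Adding a vector of argument \<open>a k\<close> to one of larger argument gives an argument above \<open>a k\<close>, so
  every summand is positive.
\<close>

lemma Im_log_series_pos:
  assumes "w \<in> punctured_closed_half_plane" "\<And>k. a k < Arg w"
  shows "0 < Im (log_series a w)"
proof -
  note s = log_series_Im_sums[OF assms(1)]
  have pos: "0 < weight k * (Arg (w + branch_offset a k) - a k)" for k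
    using Arg_add_gt[of w "branch_offset a k"] assms Re_branch_offset_pos weight_pos[of k]
    by (simp add: Arg_branch_offset)
  show ?thesis
    unfolding sums_unique[OF s] by (rule suminf_pos[OF sums_summable[OF s] pos])
qed

lemma Im_log_series_neg:
  assumes "w \<in> punctured_closed_half_plane" "\<And>k. - a k < Arg (cnj w)"
  shows "Im (log_series a w) < 0"
proof -
  interpret neg: acute_angles "\<lambda>k. - a k" by (rule acute_angles_uminus)
  have "0 < Im (log_series (\<lambda>k. - a k) (cnj w))"
    using assms by (intro neg.Im_log_series_pos) auto
  then show ?thesis using assms(1) by (simp add: log_series_cnj)
qed

lemma Arg_upper_imaginary_axis: "Re w = 0 \<Longrightarrow> 0 < Im w \<Longrightarrow> Arg w = pi / 2"
proof -
  assume "Re w = 0" "0 < Im w"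
  then have "w = of_real (Im w) * \<i>" by (simp add: complex_eq_iff)
  then show ?thesis using \<open>0 < Im w\<close> by (metis Arg_ii Arg_times_of_real)
qed

lemma Im_log_series_imaginary_axis:
  assumes "Re w = 0" "w \<noteq> 0"
  shows "Im (log_series a w) \<noteq> 0"
proof (cases "0 < Im w")
  case True
  then have "a k < Arg w" for k
    using Arg_upper_imaginary_axis[of w] assms acute[of k] by (simp add: abs_less_iff)
  then show ?thesis using Im_log_series_pos[of w] assms by force
next
  case False
  then have "0 < Im (cnj w)" using assms by (simp add: complex_eq_iff)
  then have "- a k < Arg (cnj w)" for k
    using Arg_upper_imaginary_axis[of "cnj w"] assms acute[of k] by (simp add: abs_less_iff)
  then show ?thesis using Im_log_series_neg[of w] assms by force
qed

lemma log_series_image_open: "open (log_series a ` right_half_plane)"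
  by (rule open_mapping_thm3[OF log_series_holomorphic _ log_series_inj])
     (simp add: open_halfspace_Re_gt)

text \<open>
  The translation times that stay in the image form an open set, and a closed one as well: along
  the flow the preimages move to the right, so a limit point of them cannot lie on the boundary of
  the half-plane.
\<close>

lemma log_series_translation:
  assumes w: "0 < Re w" and "0 \<le> t"
  shows "log_series a w + of_real t \<in> log_series a ` right_half_plane"
proof -
  let ?\<Omega> = "log_series a ` right_half_plane"
  define A where "A = {s \<in> {0..}. log_series a w + of_real s \<in> ?\<Omega>}"
  have "openin (top_of_set {0..}) A"
  proof -
    have "open ((\<lambda>s::real. log_series a w + of_real s) -` ?\<Omega>)"
      by (intro open_vimage log_series_image_open continuous_intros)
    moreover have "A = {0..} \<inter> (\<lambda>s::real. log_series a w + of_real s) -` ?\<Omega>"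
      by (auto simp: A_def)
    ultimately show ?thesis by (metis openin_open_Int)
  qed
  moreover have "closed A"
  proof (unfold closed_sequential_limits, intro allI impI, elim conjE)
    fix s l assume s: "\<forall>n. s n \<in> A" and l: "s \<longlonglongrightarrow> l"
    have "\<exists>u. 0 < Re u \<and> log_series a u = log_series a w + of_real (s n)" for n
    proof -
      have "log_series a w + of_real (s n) \<in> ?\<Omega>" using s by (simp add: A_def)
      then show ?thesis by (metis (mono_tags, lifting) imageE mem_Collect_eq)
    qed
    then obtain u where u: "\<And>n. 0 < Re (u n)"
      "\<And>n. log_series a (u n) = log_series a w + of_real (s n)" by metis
    have uw: "Re w \<le> Re (u n)" for n
      using Re_mono_along_translation[OF w u(1) u(2)] s by (auto simp: A_def)
    have K: "u n \<in> punctured_closed_half_plane" for n using u(1)[of n] by auto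
    have lim: "(\<lambda>n. log_series a (u n)) \<longlonglongrightarrow> log_series a w + of_real l"
      unfolding u(2) by (intro tendsto_intros l)
    obtain v r where v: "v \<in> punctured_closed_half_plane" "strict_mono r" "(u \<circ> r) \<longlonglongrightarrow> v"
      "log_series a v = log_series a w + of_real l"
      by (rule log_series_proper[OF K lim])
    have "Re w \<le> Re v"
    proof (rule LIMSEQ_le_const)
      show "(\<lambda>n. Re ((u \<circ> r) n)) \<longlonglongrightarrow> Re v" using v(3) by (rule tendsto_Re)
      show "\<exists>N. \<forall>n\<ge>N. Re w \<le> Re ((u \<circ> r) n)" using uw by auto
    qed
    then have "log_series a w + of_real l \<in> ?\<Omega>"
      using v(4) w by (metis (mono_tags, lifting) imageI mem_Collect_eq order_less_le_trans)
    moreover have "0 \<le> l" by (rule LIMSEQ_le_const[OF l]) (use s in \<open>auto simp: A_def\<close>)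
    ultimately show "l \<in> A" by (simp add: A_def)
  qed
  then have "closedin (top_of_set {0..}) A"
    by (rule closed_subset[rotated]) (auto simp: A_def)
  moreover have "0 \<in> A" using w by (auto simp: A_def)
  ultimately have "A = {0..}"
    using connected_clopen[of "{0::real..}"] by auto
  then show ?thesis using assms(2) by (auto simp: A_def)
qed

text \<open>
  The imaginary part vanishes somewhere on the unit semicircle, since it has opposite signs at
  \<open>\<i>\<close> and \<open>-\<i>\<close>.  Along the real axis the preimage cannot escape, as the series is proper and
  takes no real value on the boundary.
\<close>

lemma real_line_in_image: "of_real t \<in> log_series a ` right_half_plane"
proof -
  let ?\<Omega> = "log_series a ` right_half_plane"
  define A where "A = {s::real. of_real s \<in> ?\<Omega>}"
  have "open A"
  proof -
    have "open ((of_real :: real \<Rightarrow> complex) -` ?\<Omega>)"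
      by (intro open_vimage log_series_image_open continuous_intros)
    then show ?thesis by (simp add: A_def vimage_def)
  qed
  moreover have "closed A"
  proof (unfold closed_sequential_limits, intro allI impI, elim conjE)
    fix s l assume s: "\<forall>n. s n \<in> A" and l: "s \<longlonglongrightarrow> l"
    have "\<exists>u. 0 < Re u \<and> log_series a u = of_real (s n)" for n
    proof -
      have "of_real (s n) \<in> ?\<Omega>" using s by (simp add: A_def)
      then show ?thesis by (metis (mono_tags, lifting) imageE mem_Collect_eq)
    qed
    then obtain u where u: "\<And>n. 0 < Re (u n)" "\<And>n. log_series a (u n) = of_real (s n)"
      by metis
    have K: "u n \<in> punctured_closed_half_plane" for n using u(1)[of n] by auto
    have lim: "(\<lambda>n. log_series a (u n)) \<longlonglongrightarrow> of_real l"
      unfolding u(2) by (intro tendsto_intros l)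
    obtain v r where v: "v \<in> punctured_closed_half_plane" "log_series a v = of_real l"
      by (rule log_series_proper[OF K lim])
    then have "Re v \<noteq> 0" using Im_log_series_imaginary_axis[of v] by auto
    then have "v \<in> right_half_plane" using v by auto
    then show "l \<in> A" using v(2) by (metis (mono_tags, lifting) A_def imageI mem_Collect_eq)
  qed
  moreover have "A \<noteq> {}"
  proof -
    define f where "f x = Im (log_series a (cis x))" for x
    have c: "0 \<le> Re (cis x)" if "- (pi / 2) \<le> x" "x \<le> pi / 2" for x
      using that by (auto intro: cos_ge_zero)
    have cont: "continuous_on {- (pi / 2)..pi / 2} f" unfolding f_def
      by (intro continuous_intros continuous_on_compose2[OF log_series_continuous])
         (use c in auto)
    have lo: "f (- (pi / 2)) < 0" unfolding f_def
    proof (rule Im_log_series_neg)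
      show "- a k < Arg (cnj (cis (- (pi / 2))))" for k
        using acute[of k] by (simp add: cis_cnj abs_less_iff)
    qed simp
    have hi: "0 < f (pi / 2)" unfolding f_def
    proof (rule Im_log_series_pos)
      show "a k < Arg (cis (pi / 2))" for k using acute[of k] by (simp add: abs_less_iff)
    qed simp
    obtain x where x: "- (pi / 2) \<le> x" "x \<le> pi / 2" "f x = 0"
      using IVT'[of f "- (pi / 2)" 0 "pi / 2"] lo hi cont by auto
    then have "Re (cis x) \<noteq> 0"
      using Im_log_series_imaginary_axis[of "cis x"] by (auto simp: f_def)
    then have "cis x \<in> right_half_plane" using c[OF x(1,2)] by simp
    moreover have "log_series a (cis x) = of_real (Re (log_series a (cis x)))"
      using x(3) by (simp add: complex_eq_iff f_def)
    ultimately show ?thesis unfolding A_def by (metis (mono_tags, lifting) empty_iff imageI mem_Collect_eq)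
  qed
  ultimately have "A = UNIV" using connected_clopen[of "UNIV :: real set"] by auto
  then show ?thesis by (auto simp: A_def)
qed

text \<open>
  This is what makes the boundary fixed point super-repulsive: to gain a fixed increment of the
  series from a point \<open>w\<close> of a sector, one has to move to a point whose modulus is a large multiple
  of \<open>cmod w\<close>.  Within a bounded multiple, the change of each logarithm is uniformly bounded and
  tends to \<open>0\<close> with \<open>w\<close>, and the weights are summable.
\<close>

lemma log_series_increment_small:
  assumes "0 < \<kappa>" "0 < M" "0 < \<epsilon>"
  obtains \<rho> where "0 < \<rho>"
    "\<And>w u. 0 < cmod w \<Longrightarrow> cmod w < \<rho> \<Longrightarrow> \<kappa> * cmod w \<le> Re w \<Longrightarrow> Re w \<le> Re u \<Longrightarrow>
      cmod u \<le> M * cmod w \<Longrightarrow> cmod (log_series a u - log_series a w) < \<epsilon>"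
proof -
  have sm: "summable (\<lambda>k. weight k * ((M + 1) / \<kappa>))" by (intro summable_mult2 weight_summable)
  obtain N where N: "\<And>n. n \<ge> N \<Longrightarrow> norm (\<Sum>k. weight (k + n) * ((M + 1) / \<kappa>)) < \<epsilon> / 2"
    using suminf_exist_split[OF _ sm, of "\<epsilon> / 2"] assms by auto
  define C where "C = (\<Sum>k<N. weight k * ((M + 1) / Re (branch_offset a k)))"
  have C: "0 \<le> C" unfolding C_def using assms weight_pos Re_branch_offset_pos
    by (intro sum_nonneg mult_nonneg_nonneg divide_nonneg_pos) (auto simp: less_imp_le)
  show ?thesis
  proof (rule that)
    show "0 < \<epsilon> / (2 * (C + 1))" using assms C by simp
    fix w u assume w: "0 < cmod w" "cmod w < \<epsilon> / (2 * (C + 1))" "\<kappa> * cmod w \<le> Re w"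
      and u: "Re w \<le> Re u" "cmod u \<le> M * cmod w"
    have wpos: "0 < Re w" using w assms by (meson mult_pos_pos order_less_le_trans)
    define D where "D k = log_term a k u - log_term a k w" for k
    have D: "D sums (log_series a u - log_series a w)"
      unfolding D_def using wpos u by (intro sums_diff log_series_sums) auto
    have bd: "cmod (D k) \<le> weight k * ((M + 1) * cmod w / d)"
      if d: "0 < d" "d \<le> Re (w + branch_offset a k)" for k d
    proof -
      have "cmod (Ln (u + branch_offset a k) - Ln (w + branch_offset a k))
          \<le> cmod ((u + branch_offset a k) - (w + branch_offset a k)) / d"
      proof (rule cmod_Ln_diff_le)
        show "convex {v. d \<le> Re v}" by (rule convex_halfspace_Re_ge)
        fix v assume "v \<in> {v. d \<le> Re v}"
        then show "0 < Re v \<and> d \<le> cmod v" using d complex_Re_le_cmod[of v] by auto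
      qed (use d u in auto)
      also have "\<dots> \<le> (M + 1) * cmod w / d"
        using d u norm_triangle_ineq4[of u w] by (intro divide_right_mono) (auto simp: algebra_simps)
      finally have *: "cmod (Ln (u + branch_offset a k) - Ln (w + branch_offset a k))
        \<le> (M + 1) * cmod w / d" .
      have "D k = of_real (weight k) * (Ln (u + branch_offset a k) - Ln (w + branch_offset a k))"
        by (simp add: D_def log_term_def algebra_simps)
      then have "cmod (D k) = weight k * cmod (Ln (u + branch_offset a k) - Ln (w + branch_offset a k))"
        using weight_pos[of k] by (simp add: norm_mult)
      then show ?thesis using mult_left_mono[OF * less_imp_le[OF weight_pos[of k]]] by simp
    qed
    \<comment> \<open>The sector gives a bound that does not depend on \<open>k\<close>; it controls the tail.\<close>
    have "cmod (D k) \<le> weight k * ((M + 1) / \<kappa>)" for k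
    proof -
      have "\<kappa> * cmod w \<le> Re (w + branch_offset a k)"
        using w Re_branch_offset_pos[of k] by simp
      then have "cmod (D k) \<le> weight k * ((M + 1) * cmod w / (\<kappa> * cmod w))"
        using w assms by (intro bd) auto
      then show ?thesis using w by simp
    qed
    then have "cmod (\<Sum>k. D (k + N)) \<le> (\<Sum>k. weight (k + N) * ((M + 1) / \<kappa>))"
      by (intro norm_suminf_le summable_ignore_initial_segment[OF sm]) auto
    also have "\<dots> < \<epsilon> / 2" using N[of N] by (simp del: times_divide_eq_right)
    finally have tail: "cmod (\<Sum>k. D (k + N)) < \<epsilon> / 2" .
    \<comment> \<open>For finitely many \<open>k\<close> the branch points have a positive distance from the half-plane.\<close>
    have "cmod (\<Sum>k<N. D k) \<le> (\<Sum>k<N. weight k * ((M + 1) * cmod w / Re (branch_offset a k)))"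
      using wpos Re_branch_offset_pos by (intro sum_norm_le bd) auto
    also have "\<dots> = C * cmod w" unfolding C_def sum_distrib_right
      by (intro sum.cong) auto
    also have "\<dots> \<le> (C + 1) * cmod w" by (intro mult_right_mono) auto
    also have "\<dots> < (C + 1) * (\<epsilon> / (2 * (C + 1)))" using w C by (intro mult_strict_left_mono) auto
    also have "\<dots> = \<epsilon> / 2" using C by (simp add: field_simps)
    finally have "cmod (\<Sum>k<N. D k) < \<epsilon> / 2" .
    moreover have "log_series a u - log_series a w = (\<Sum>k. D (k + N)) + (\<Sum>k<N. D k)"
      using suminf_split_initial_segment[OF sums_summable[OF D], of N] sums_unique[OF D] by simp
    ultimately show "cmod (log_series a u - log_series a w) < \<epsilon>"
      using tail norm_triangle_ineq[of "\<Sum>k. D (k + N)" "\<Sum>k<N. D k"] by simp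
  qed
qed

section \<open>The sign of the imaginary part\<close>

text \<open>
  For small \<open>w\<close> this is the mean value estimate for the logarithm; otherwise the right-hand side
  exceeds \<open>pi\<close>.
\<close>

lemma Arg_increment_le:
  assumes w: "0 < Re w"
  shows "\<bar>Arg (w + branch_offset a k) - a k\<bar> \<le> 2 * pi * cmod w / radius k"
proof (cases "cmod w \<le> radius k / 2")
  case True
  let ?e = "branch_offset a k"
  have pi: "1 \<le> pi" using pi_gt3 by simp
  have "cmod (Ln (?e + w) - Ln ?e) \<le> cmod (?e + w - ?e) / (radius k / 2)"
  proof (rule cmod_Ln_diff_le)
    show "convex (closed_segment ?e (?e + w))" by simp
    fix u assume "u \<in> closed_segment ?e (?e + w)"
    then obtain t where t: "0 \<le> t" "t \<le> 1" "u = ?e + of_real t * w"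
      by (auto simp: in_segment scaleR_conv_of_real algebra_simps)
    have "0 < Re u" using t w Re_branch_offset_pos[of k] by (simp add: add_pos_nonneg)
    moreover have "cmod (of_real t * w) \<le> 1 * cmod w"
      unfolding norm_mult using t by (intro mult_right_mono) auto
    then have "radius k / 2 \<le> cmod u"
      using True t(3) norm_diff_ineq[of ?e "of_real t * w"] by (simp add: cmod_branch_offset)
    ultimately show "0 < Re u \<and> radius k / 2 \<le> cmod u" ..
  qed (use radius_pos in auto)
  moreover have "Arg (w + ?e) - a k = Im (Ln (?e + w) - Ln ?e)"
    using Arg_branch_offset[of k] add_branch_offset_nonzero[of w k] w branch_offset_nonzero[of k]
    by (simp add: Arg_eq_Im_Ln add.commute)
  ultimately have "\<bar>Arg (w + ?e) - a k\<bar> \<le> cmod w / (radius k / 2)"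
    using abs_Im_le_cmod[of "Ln (?e + w) - Ln ?e"] by simp
  also have "\<dots> = 1 * (2 * cmod w / radius k)" by simp
  also have "\<dots> \<le> pi * (2 * cmod w / radius k)"
    using pi radius_pos[of k] by (intro mult_right_mono) (auto simp: less_imp_le)
  finally show ?thesis by (simp add: mult_ac)
next
  case False
  have "\<bar>Arg (w + branch_offset a k)\<bar> < pi / 2"
    using w by (intro Arg_bound_half_plane Re_add_branch_offset_pos) auto
  then have "\<bar>Arg (w + branch_offset a k) - a k\<bar> \<le> pi * 1" using acute[of k] by linarith
  also have "\<dots> \<le> pi * (2 * cmod w / radius k)"
    using False radius_pos[of k] by (intro mult_left_mono) (auto simp: field_simps)
  finally show ?thesis by (simp add: mult_ac)
qed

lemma Arg_increment_ge_half:
  assumes "0 < Re w" "radius k \<le> cmod w" "a k + \<delta> \<le> Arg w" "0 \<le> \<delta>"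
  shows "\<delta> / 2 \<le> Arg (w + branch_offset a k) - a k"
proof -
  have "(Arg w + a k) / 2 \<le> Arg (w + branch_offset a k)"
    using Arg_add_ge_midpoint[of w "branch_offset a k"] assms Re_branch_offset_pos[of k]
    by (simp add: Arg_branch_offset cmod_branch_offset)
  then show ?thesis using assms(3) by (simp add: field_simps)
qed

text \<open>
  Let \<open>radius n\<close> be the largest radius that does not exceed \<open>cmod w\<close>.  Summand number \<open>n\<close> is at
  least \<open>\<delta> / 2\<close> times its weight, and this beats the summands before \<open>k0\<close>, the only ones that can
  be negative, because they are of the order \<open>cmod w < radius (n - 1)\<close>.
\<close>

lemma Im_log_series_pos_near_0:
  assumes b: "\<And>k. k \<ge> k0 \<Longrightarrow> a k \<le> b" and \<delta>: "0 < \<delta>"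
  obtains \<rho> where "0 < \<rho>"
    "\<And>w. 0 < Re w \<Longrightarrow> cmod w < \<rho> \<Longrightarrow> b + \<delta> \<le> Arg w \<Longrightarrow> 0 < Im (log_series a w)"
proof -
  define C where "C = (\<Sum>k<k0. weight k * (2 * pi / radius k))"
  have C: "0 \<le> C" unfolding C_def
    by (intro sum_nonneg) (simp add: weight_pos radius_pos less_imp_le)
  have "\<forall>\<^sub>F n in sequentially. radius n / weight (Suc n) < \<delta> / (2 * (C + 1))"
    by (rule order_tendstoD(2)[OF radius_over_next_weight]) (use \<delta> C in simp)
  then obtain N where N: "\<And>n. N \<le> n \<Longrightarrow> radius n / weight (Suc n) < \<delta> / (2 * (C + 1))"
    unfolding eventually_sequentially by blast
  show ?thesis
  proof (rule that)
    show "0 < radius (max k0 N)" by (rule radius_pos)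
    fix w assume w: "0 < Re w" "cmod w < radius (max k0 N)" "b + \<delta> \<le> Arg w"
    have wnz: "0 < cmod w" using w(1) by auto
    define x where "x k = weight k * (Arg (w + branch_offset a k) - a k)" for k
    have x: "x sums Im (log_series a w)"
      unfolding x_def using w by (intro log_series_Im_sums) auto
    have "\<exists>n. radius n \<le> cmod w"
      using order_tendstoD(2)[OF radius_tendsto_0 wnz]
      by (auto simp: eventually_sequentially intro: less_imp_le)
    then have ex: "radius (LEAST n. radius n \<le> cmod w) \<le> cmod w" by (rule LeastI_ex)
    define n where "n = (LEAST n. radius n \<le> cmod w)"
    have n: "radius n \<le> cmod w" using ex by (simp add: n_def)
    have nbig: "max k0 N < n"
    proof (rule ccontr)
      assume "\<not> max k0 N < n"
      then have "radius (max k0 N) \<le> radius n" by (intro radius_antimono) (simp only: not_less)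
      then show False using n w by linarith
    qed
    then have nk: "\<not> n < k0" by simp
    obtain m where m: "n = Suc m" using nbig by (cases n) auto
    have wm: "cmod w < radius m"
      using not_less_Least[of m "\<lambda>n. radius n \<le> cmod w"] m unfolding n_def[symmetric] by simp
    have tail: "0 \<le> x k" if "k \<ge> k0" for k
    proof -
      have "a k \<le> Arg (w + branch_offset a k)"
        using w b[OF that] \<delta> acute[of k] Re_branch_offset_pos[of k]
        by (intro Arg_add_ge) (auto simp: Arg_branch_offset)
      then show ?thesis using weight_pos[of k] by (simp add: x_def)
    qed
    have "weight n * (\<delta> / 2) \<le> x n" unfolding x_def
      using w n \<delta> b[of n] nbig weight_pos[of n] by (intro mult_left_mono Arg_increment_ge_half) auto
    moreover have "- (C * cmod w) \<le> (\<Sum>k<k0. x k)"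
    proof -
      have "- (weight k * (2 * pi / radius k) * cmod w) \<le> x k" for k
      proof -
        have "- (2 * pi * cmod w / radius k) \<le> Arg (w + branch_offset a k) - a k"
          using Arg_increment_le[OF w(1), of k] by linarith
        from mult_left_mono[OF this less_imp_le[OF weight_pos[of k]]]
        show ?thesis by (simp add: x_def mult_ac)
      qed
      then have "(\<Sum>k<k0. - (weight k * (2 * pi / radius k) * cmod w)) \<le> (\<Sum>k<k0. x k)"
        by (intro sum_mono)
      then show ?thesis by (simp add: C_def sum_distrib_right sum_negf)
    qed
    moreover have "C * cmod w < weight n * (\<delta> / 2)"
    proof -
      have "C * cmod w \<le> (C + 1) * radius m" using wm C by (intro mult_mono) auto
      also have "\<dots> < weight n * (\<delta> / 2)"
        using N[of m] nbig C weight_pos[of n] by (simp add: m field_simps)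
      finally show ?thesis .
    qed
    moreover have "sum x (insert n {..<k0}) \<le> suminf x"
      by (rule sum_le_suminf[OF sums_summable[OF x]]) (auto intro: tail)
    then have "x n + (\<Sum>k<k0. x k) \<le> Im (log_series a w)"
      using nk sums_unique[OF x] by simp
    ultimately show "0 < Im (log_series a w)" by linarith
  qed
qed

text \<open>
  On the circle of radius \<open>radius n\<close> the sign is decided by summand number \<open>n\<close> alone: the later
  weights are negligible against \<open>weight n\<close>, and the arguments in the earlier summands have not
  yet moved.
\<close>

lemma Im_log_series_pos_on_circle:
  assumes \<delta>: "0 < \<delta>"
  shows "\<forall>\<^sub>F n in sequentially. \<forall>w. 0 < Re w \<longrightarrow> cmod w = radius n \<longrightarrow> a n + \<delta> \<le> Arg w \<longrightarrow>
    0 < Im (log_series a w)"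
proof -
  define W where "W = suminf weight"
  define tl where "tl n = (\<Sum>j. weight (j + Suc n))" for n
  have "(\<lambda>m. 2 * pi * W * (radius (Suc m) / radius m / weight (Suc m))
      + pi * (tl (Suc m) / weight (Suc m))) \<longlonglongrightarrow> 2 * pi * W * 0 + pi * 0"
    unfolding tl_def
    by (intro tendsto_intros radius_ratio_over_weight LIMSEQ_Suc[OF weight_tail_ratio])
  then have "\<forall>\<^sub>F m in sequentially. 2 * pi * W * (radius (Suc m) / radius m / weight (Suc m))
      + pi * (tl (Suc m) / weight (Suc m)) < \<delta> / 2"
    by (rule order_tendstoD(2)) (use \<delta> in simp)
  then have "\<forall>\<^sub>F m in sequentially. \<forall>w. 0 < Re w \<longrightarrow> cmod w = radius (Suc m) \<longrightarrow>
      a (Suc m) + \<delta> \<le> Arg w \<longrightarrow> 0 < Im (log_series a w)"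
  proof (rule eventually_mono, intro allI impI)
    fix m w
    assume m: "2 * pi * W * (radius (Suc m) / radius m / weight (Suc m))
      + pi * (tl (Suc m) / weight (Suc m)) < \<delta> / 2"
      and w: "0 < Re w" "cmod w = radius (Suc m)" "a (Suc m) + \<delta> \<le> Arg w"
    define n where "n = Suc m"
    define x where "x k = weight k * (Arg (w + branch_offset a k) - a k)" for k
    have x: "x sums Im (log_series a w)"
      unfolding x_def using w by (intro log_series_Im_sums) auto
    have xn: "weight n * (\<delta> / 2) \<le> x n" unfolding x_def
      using w \<delta> weight_pos[of n] by (intro mult_left_mono Arg_increment_ge_half) (auto simp: n_def)
    define q where "q = 2 * pi * radius n / radius m"
    have q: "0 \<le> q" by (simp add: q_def radius_pos less_imp_le)
    have "- (q * W) \<le> (\<Sum>k<n. x k)"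
    proof -
      have "- (weight k * q) \<le> x k" if "k < n" for k
      proof -
        have "2 * pi * cmod w / radius k \<le> q" unfolding q_def
          using that w(2) radius_pos radius_antimono[of k m]
          by (intro frac_le) (auto simp: n_def less_imp_le)
        then have "- q \<le> Arg (w + branch_offset a k) - a k"
          using Arg_increment_le[OF w(1), of k] by linarith
        from mult_left_mono[OF this less_imp_le[OF weight_pos[of k]]]
        show ?thesis by (simp add: x_def)
      qed
      then have "(\<Sum>k<n. - (weight k * q)) \<le> (\<Sum>k<n. x k)" by (intro sum_mono) auto
      moreover have "(\<Sum>k<n. weight k) * q \<le> W * q" unfolding W_def using q
        by (intro mult_right_mono sum_le_suminf weight_summable) (auto simp: weight_pos less_imp_le)
      moreover have "(\<Sum>k<n. - (weight k * q)) = - ((\<Sum>k<n. weight k) * q)"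
        by (simp add: sum_negf sum_distrib_right)
      ultimately show ?thesis by (simp only: mult.commute[of q W])
    qed
    moreover have "- (pi * tl n) \<le> (\<Sum>j. x (j + Suc n))"
    proof -
      have "weight k * (- pi) \<le> x k" for k unfolding x_def
      proof (intro mult_left_mono)
        have "\<bar>Arg (w + branch_offset a k)\<bar> < pi / 2"
          using w by (intro Arg_bound_half_plane Re_add_branch_offset_pos) auto
        then show "- pi \<le> Arg (w + branch_offset a k) - a k" using acute[of k] by linarith
      qed (simp add: weight_pos less_imp_le)
      then have "(\<Sum>j. weight (j + Suc n) * (- pi)) \<le> (\<Sum>j. x (j + Suc n))"
        by (intro suminf_le summable_mult2 summable_ignore_initial_segment weight_summable
            sums_summable[OF x])
      moreover have "(\<Sum>j. weight (j + Suc n) * (- pi)) = tl n * (- pi)" unfolding tl_def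
        by (rule suminf_mult2[symmetric]) (intro summable_ignore_initial_segment weight_summable)
      ultimately show ?thesis by (simp add: mult.commute)
    qed
    moreover have "Im (log_series a w) = (\<Sum>j. x (j + Suc n)) + ((\<Sum>k<n. x k) + x n)"
      using suminf_split_initial_segment[OF sums_summable[OF x], of "Suc n"] sums_unique[OF x]
      by simp
    moreover have "q * W + pi * tl n < weight n * (\<delta> / 2)"
    proof -
      have "q * W + pi * tl n = weight n * (2 * pi * W * (radius n / radius m / weight n)
          + pi * (tl n / weight n))"
        using weight_pos[of n] by (simp add: q_def field_simps)
      also have "\<dots> < weight n * (\<delta> / 2)"
        using m weight_pos[of n] unfolding n_def[symmetric] by (intro mult_strict_left_mono)
      finally show ?thesis .
    qed
    ultimately show "0 < Im (log_series a w)" using xn by linarith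
  qed
  then show ?thesis by (subst (asm) eventually_sequentially_Suc)
qed

end

section \<open>Limit sets at the left end\<close>

lemma ereal_tendsto_MInfty_iff:
  "((\<lambda>x. ereal (f x)) \<longlongrightarrow> - \<infinity>) F \<longleftrightarrow> filterlim f at_bot F"
  by (simp add: tendsto_MInfty filterlim_at_bot_dense)

lemma alpha_limit_set_at_bot:
  "alpha_limit_set (- \<infinity>) \<infinity> \<Gamma> =
    {p. \<exists>t. strict_antimono_on UNIV t \<and> filterlim t at_bot sequentially \<and> (\<lambda>n. \<Gamma> (t n)) \<longlonglongrightarrow> p}"
  by (simp add: alpha_limit_set_def ereal_tendsto_MInfty_iff)

lemma alpha_limit_set_tendsto:
  fixes \<Gamma> :: "real \<Rightarrow> 'a::t2_space"
  assumes "(\<Gamma> \<longlongrightarrow> p) at_bot"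
  shows "alpha_limit_set (- \<infinity>) \<infinity> \<Gamma> = {p}"
proof -
  have lim: "(\<lambda>n. \<Gamma> (t n)) \<longlonglongrightarrow> p" if "filterlim t at_bot sequentially" for t :: "nat \<Rightarrow> real"
    using filterlim_compose[OF assms that] .
  have "filterlim (\<lambda>n. - real n) at_bot sequentially"
    by (rule filterlim_compose[OF filterlim_uminus_at_bot_at_top filterlim_real_sequentially])
  moreover have "strict_antimono_on UNIV (\<lambda>n. - real n)" by (auto intro: monotone_onI)
  ultimately have "p \<in> alpha_limit_set (- \<infinity>) \<infinity> \<Gamma>"
    unfolding alpha_limit_set_at_bot using lim by blast
  moreover have "q = p" if "q \<in> alpha_limit_set (- \<infinity>) \<infinity> \<Gamma>" for q
    using that lim LIMSEQ_unique unfolding alpha_limit_set_at_bot by blast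
  ultimately show ?thesis by blast
qed

text \<open>
  By continuity a curve that comes close to both ends of an interval infinitely often also takes
  values close to every intermediate point.
\<close>

lemma alpha_limit_set_eq_Icc:
  fixes f :: "real \<Rightarrow> real"
  assumes cont: "continuous_on UNIV f" and "l \<le> u"
    and ev: "\<And>e. 0 < e \<Longrightarrow> \<forall>\<^sub>F t in at_bot. l - e < f t \<and> f t < u + e"
    and lo: "\<And>e. 0 < e \<Longrightarrow> \<exists>\<^sub>F t in at_bot. f t < l + e"
    and hi: "\<And>e. 0 < e \<Longrightarrow> \<exists>\<^sub>F t in at_bot. u - e < f t"
  shows "alpha_limit_set (- \<infinity>) \<infinity> f = {l..u}"
proof (intro equalityI subsetI)
  fix p assume "p \<in> alpha_limit_set (- \<infinity>) \<infinity> f"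
  then obtain t where t: "filterlim t at_bot sequentially" "(\<lambda>n. f (t n)) \<longlonglongrightarrow> p"
    unfolding alpha_limit_set_at_bot by blast
  have b: "l - e \<le> p \<and> p \<le> u + e" if "0 < e" for e
  proof -
    have "\<forall>\<^sub>F n in sequentially. l - e < f (t n) \<and> f (t n) < u + e"
      using t(1) ev[OF that] by (rule filterlim_iff[THEN iffD1, rule_format])
    then have "\<forall>\<^sub>F n in sequentially. l - e \<le> f (t n)" "\<forall>\<^sub>F n in sequentially. f (t n) \<le> u + e"
      by (auto elim: eventually_mono)
    then show ?thesis using t(2) by (auto intro: tendsto_lowerbound tendsto_upperbound)
  qed
  have "l \<le> p" by (rule field_le_epsilon) (use b in force)
  moreover have "p \<le> u" by (rule field_le_epsilon) (use b in force)
  ultimately show "p \<in> {l..u}" by simp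
next
  fix p assume p: "p \<in> {l..u}"
  have near: "\<exists>t<T. \<bar>f t - p\<bar> < e" if e: "0 < e" for T e
  proof -
    have T: "\<forall>\<^sub>F t in at_bot. t < T" by (rule eventually_gt_at_bot)
    obtain t1 where t1: "f t1 < l + e" "t1 < T"
      using frequently_ex[OF frequently_eventually_frequently[OF lo[OF e] T]] by auto
    obtain t2 where t2: "u - e < f t2" "t2 < T"
      using frequently_ex[OF frequently_eventually_frequently[OF hi[OF e] T]] by auto
    consider "p < f t1" | "f t2 < p" | "f t1 \<le> p" "p \<le> f t2" by linarith
    then show ?thesis
    proof cases
      case 1
      then show ?thesis using t1 p e by (intro exI[of _ t1]) auto
    next
      case 2
      then show ?thesis using t2 p e by (intro exI[of _ t2]) auto
    next
      case 3
      have "connected (f ` {..<T})"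
        by (intro connected_continuous_image continuous_on_subset[OF cont]) auto
      then have "{f t1..f t2} \<subseteq> f ` {..<T}"
        using t1 t2 by (intro connected_contains_Icc) auto
      then obtain t where "t < T" "f t = p" using 3 by auto
      then show ?thesis using e by auto
    qed
  qed
  have "\<exists>t. \<forall>n. (t n < - real n \<and> \<bar>f (t n) - p\<bar> < inverse (real (Suc n))) \<and> t (Suc n) < t n"
  proof (rule dependent_nat_choice)
    show "\<exists>x. x < - real 0 \<and> \<bar>f x - p\<bar> < inverse (real (Suc 0))" by (rule near) simp
    show "\<exists>y. (y < - real (Suc n) \<and> \<bar>f y - p\<bar> < inverse (real (Suc (Suc n)))) \<and> y < x" for x n
      using near[of "inverse (real (Suc (Suc n)))" "min (- real (Suc n)) x"] by auto
  qed
  then obtain t where t: "\<And>n. t n < - real n" "\<And>n. \<bar>f (t n) - p\<bar> < inverse (real (Suc n))"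
    "\<And>n. t (Suc n) < t n" by blast
  have "t n < t m" if "m < n" for m n
    using lift_Suc_mono_less[of "\<lambda>n. - t n" m n] t(3) that by simp
  then have "strict_antimono_on UNIV t" by (auto intro: monotone_onI)
  moreover have "filterlim t at_bot sequentially"
  proof (rule filterlim_at_bot_mono)
    show "filterlim (\<lambda>n. - real n) at_bot sequentially"
      by (rule filterlim_compose[OF filterlim_uminus_at_bot_at_top filterlim_real_sequentially])
    show "\<forall>\<^sub>F n in sequentially. t n \<le> - real n" using t(1) by (simp add: less_imp_le)
  qed
  moreover have "(\<lambda>n. f (t n)) \<longlonglongrightarrow> p"
  proof (rule LIM_zero_cancel, rule tendsto_0_le[OF LIMSEQ_inverse_real_of_nat])
    show "\<forall>\<^sub>F n in sequentially. norm (f (t n) - p) \<le> norm (inverse (real (Suc n))) * 1"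
      using t(2) by (simp add: less_imp_le)
  qed
  ultimately show "p \<in> alpha_limit_set (- \<infinity>) \<infinity> f"
    unfolding alpha_limit_set_at_bot by blast
qed

section \<open>Semigroups of translations in the image of a univalent function\<close>

definition translation_semigroup :: "(complex \<Rightarrow> complex) \<Rightarrow> real \<Rightarrow> complex \<Rightarrow> complex"
  where "translation_semigroup h t z = inv_into \<bbbD> h (h z + of_real t)"

lemma inv_into_holomorphic:
  assumes "h holomorphic_on S" "open S" "inj_on h S"
  shows "inv_into S h holomorphic_on h ` S"
proof -
  obtain g where g: "g holomorphic_on h ` S" "\<And>z. z \<in> S \<Longrightarrow> g (h z) = z"
    using holomorphic_has_inverse[OF assms] by metis
  show ?thesis
    by (rule holomorphic_transform[OF g(1)]) (use g(2) assms(3) in auto)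
qed

locale translation_domain =
  fixes h :: "complex \<Rightarrow> complex"
  assumes hol: "h holomorphic_on \<bbbD>" and inj: "inj_on h \<bbbD>"
    and translation: "\<And>z t. z \<in> \<bbbD> \<Longrightarrow> 0 \<le> t \<Longrightarrow> h z + of_real t \<in> h ` \<bbbD>"
begin

lemma semigroup_in_disk:
  assumes "z \<in> \<bbbD>" "0 \<le> t"
  shows "translation_semigroup h t z \<in> \<bbbD>"
  unfolding translation_semigroup_def by (rule inv_into_into[OF translation[OF assms]])

lemma koenigs_equation:
  assumes "z \<in> \<bbbD>" "0 \<le> t"
  shows "h (translation_semigroup h t z) = h z + of_real t"
  unfolding translation_semigroup_def by (rule f_inv_into_f[OF translation[OF assms]])

lemma koenigs_function: "koenigs_function (translation_semigroup h) h"
  unfolding koenigs_function_def using hol inj koenigs_equation by auto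

lemma non_elliptic: "non_elliptic (translation_semigroup h)"
  unfolding non_elliptic_def
proof (intro allI ballI impI notI)
  fix t :: real and z assume *: "0 < t" "z \<in> \<bbbD>" "translation_semigroup h t z = z"
  then show False using koenigs_equation[of z t] by simp
qed

lemma holomorphic_semigroup: "holomorphic_semigroup (translation_semigroup h)"
  unfolding holomorphic_semigroup_def
proof (intro conjI allI impI ballI)
  note inv = inv_into_holomorphic[OF hol open_ball inj]
  fix t :: real assume t: "0 \<le> t"
  have "(inv_into \<bbbD> h \<circ> (\<lambda>z. h z + of_real t)) holomorphic_on \<bbbD>"
    by (rule holomorphic_on_compose_gen[OF _ inv])
       (use t translation in \<open>auto intro!: holomorphic_intros hol\<close>)
  then show "translation_semigroup h t holomorphic_on \<bbbD>"
    by (simp add: o_def translation_semigroup_def[abs_def])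
  show "translation_semigroup h t ` \<bbbD> \<subseteq> \<bbbD>" using semigroup_in_disk t by blast
  fix s :: real and z assume s: "0 \<le> s" "z \<in> \<bbbD>"
  have "h (translation_semigroup h t (translation_semigroup h s z)) = h (translation_semigroup h (t + s) z)"
    using s t koenigs_equation[OF semigroup_in_disk[OF s(2,1)] t] koenigs_equation[OF s(2,1)]
      koenigs_equation[of z "t + s"] by simp
  then show "translation_semigroup h (t + s) z = translation_semigroup h t (translation_semigroup h s z)"
    using s t inj_onD[OF inj] by (metis semigroup_in_disk add_nonneg_nonneg)
next
  fix z assume z: "z \<in> \<bbbD>"
  then show "translation_semigroup h 0 z = z"
    using inj by (simp add: translation_semigroup_def)
  fix s :: real assume s: "0 \<le> s"
  have "continuous_on {0..} (\<lambda>t. inv_into \<bbbD> h (h z + of_real t))"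
    by (rule continuous_on_compose2[OF holomorphic_on_imp_continuous_on[OF
            inv_into_holomorphic[OF hol open_ball inj]]])
       (use z translation in \<open>auto intro!: continuous_intros simp del: mem_ball\<close>)
  then show "((\<lambda>t. translation_semigroup h t z) \<longlongrightarrow> translation_semigroup h s z) (at s within {0..})"
    unfolding translation_semigroup_def using s by (simp add: continuous_on_def)
qed

end

section \<open>Transfer to the disk\<close>

definition cayley :: "complex \<Rightarrow> complex"
  where "cayley z = (1 - z) / (1 + z)"

lemma disk_one_plus_Re: "z \<in> \<bbbD> \<Longrightarrow> 0 < Re (1 + z)"
  using abs_Re_le_cmod[of z] by simp

lemma disk_one_plus_nonzero: "z \<in> \<bbbD> \<Longrightarrow> 1 + z \<noteq> 0"
  using disk_one_plus_Re[of z] by (metis less_irrefl zero_complex.sel(1))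

lemma half_plane_one_plus_nonzero: "0 < Re w \<Longrightarrow> 1 + w \<noteq> 0"
  by (auto simp: complex_eq_iff)

lemma cayley_involution: "1 + z \<noteq> 0 \<Longrightarrow> cayley (cayley z) = z"
  by (simp add: cayley_def divide_simps)

lemma Re_cayley: "Re (cayley z) = (1 - (cmod z)\<^sup>2) / (cmod (1 + z))\<^sup>2"
  unfolding cayley_def Re_divide cmod_power2
  by (simp add: power2_eq_square algebra_simps)

lemma cayley_in_half_plane:
  assumes "z \<in> \<bbbD>"
  shows "0 < Re (cayley z)"
proof -
  have "(cmod z)\<^sup>2 < 1" using assms by (simp add: power_less_one_iff)
  then show ?thesis using disk_one_plus_nonzero[OF assms] by (simp add: Re_cayley)
qed

lemma cayley_in_disk:
  assumes "0 < Re w"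
  shows "cayley w \<in> \<bbbD>"
proof -
  have "(cmod (1 - w))\<^sup>2 < (cmod (1 + w))\<^sup>2"
    using assms unfolding cmod_power2 by (simp add: power2_eq_square algebra_simps)
  then have "cmod (1 - w) < cmod (1 + w)" by (rule power_less_imp_less_base) simp
  then show ?thesis by (simp add: cayley_def norm_divide divide_less_eq)
qed

lemma cayley_image_disk: "cayley ` \<bbbD> = right_half_plane"
proof (intro equalityI subsetI)
  fix w assume "w \<in> right_half_plane"
  then have "w = cayley (cayley w)" "cayley w \<in> \<bbbD>"
    using cayley_involution half_plane_one_plus_nonzero cayley_in_disk by auto
  then show "w \<in> cayley ` \<bbbD>" by blast
qed (auto simp: cayley_in_half_plane simp del: mem_ball)

lemma cayley_inj: "inj_on cayley \<bbbD>"
  using cayley_involution disk_one_plus_nonzero by (metis inj_onI)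

lemma cayley_holomorphic: "cayley holomorphic_on \<bbbD>"
  unfolding cayley_def[abs_def] using disk_one_plus_nonzero
  by (intro holomorphic_intros) auto

lemma one_minus_eq_cayley: "z \<in> \<bbbD> \<Longrightarrow> 1 - z = cayley z * (1 + z)"
  using disk_one_plus_nonzero by (simp add: cayley_def)

lemma cayley_tendsto_0: "(cayley \<longlongrightarrow> 0) (at 1 within \<bbbD>)"
proof -
  have "(cayley \<longlongrightarrow> (1 - 1) / (1 + 1)) (at 1 within \<bbbD>)"
    unfolding cayley_def[abs_def] by (intro tendsto_intros) auto
  then show ?thesis by simp
qed

lemma cayley_filterlim: "filterlim cayley (at 0 within {w. 0 \<le> Re w}) (at 1 within \<bbbD>)"
  unfolding filterlim_at
proof
  have "\<forall>\<^sub>F z in at 1 within \<bbbD>. z \<in> \<bbbD>" by (simp add: eventually_at_filter)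
  then show "\<forall>\<^sub>F z in at 1 within \<bbbD>. cayley z \<in> {w. 0 \<le> Re w} \<and> cayley z \<noteq> 0"
    by (rule eventually_mono) (use cayley_in_half_plane in force)
qed (rule cayley_tendsto_0)

text \<open>A Stolz region at \<open>1\<close> corresponds to a sector of the half-plane.\<close>

lemma Re_cayley_stolz:
  assumes "z \<in> stolz_region 1 M" "0 < M"
  shows "1 / (2 * M) * cmod (cayley z) \<le> Re (cayley z)"
proof -
  have z: "z \<in> \<bbbD>" "cmod (1 - z) < M * (1 - cmod z)" using assms by (auto simp: stolz_region_def)
  define q where "q = cmod (1 + z)"
  have q: "0 < q" "q \<le> 2"
    using disk_one_plus_nonzero[OF z(1)] norm_triangle_ineq[of 1 z] z(1) by (auto simp: q_def)
  have "cmod (1 - z) * q \<le> cmod (1 - z) * 2" using q by (intro mult_left_mono) auto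
  also have "\<dots> \<le> 2 * M * (1 - cmod z)" using z(2) by simp
  also have "\<dots> \<le> 2 * M * (1 - (cmod z)\<^sup>2)"
  proof (intro mult_left_mono)
    have "cmod z * cmod z \<le> cmod z * 1" using z(1) by (intro mult_left_mono) auto
    then show "1 - cmod z \<le> 1 - (cmod z)\<^sup>2" by (simp add: power2_eq_square)
  qed (use assms in auto)
  finally have "cmod (1 - z) * q \<le> 2 * M * (1 - (cmod z)\<^sup>2)" .
  then have "cmod (1 - z) / q \<le> 2 * M * ((1 - (cmod z)\<^sup>2) / q\<^sup>2)"
    using q by (simp add: field_simps power2_eq_square)
  then have "cmod (cayley z) \<le> 2 * M * Re (cayley z)"
    unfolding Re_cayley q_def[symmetric] by (simp add: cayley_def norm_divide q_def[symmetric])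
  then show ?thesis using assms(2) by (simp add: divide_le_eq mult_ac)
qed

definition disk_log_series :: "(nat \<Rightarrow> real) \<Rightarrow> complex \<Rightarrow> complex"
  where "disk_log_series a z = log_series a (cayley z)"

context acute_angles
begin

lemma disk_log_series_image: "disk_log_series a ` \<bbbD> = log_series a ` right_half_plane"
  unfolding disk_log_series_def cayley_image_disk[symmetric] by (simp add: image_image)

sublocale translation_domain "disk_log_series a"
proof
  show "disk_log_series a holomorphic_on \<bbbD>"
    unfolding disk_log_series_def[abs_def]
    using holomorphic_on_compose[OF cayley_holomorphic, of "log_series a"] log_series_holomorphic
    by (simp add: cayley_image_disk o_def)
  show "inj_on (disk_log_series a) \<bbbD>"
    unfolding disk_log_series_def[abs_def]
    using comp_inj_on[OF cayley_inj, of "log_series a"] log_series_inj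
    by (simp add: cayley_image_disk o_def)
  fix z :: complex and t :: real
  assume "z \<in> \<bbbD>" "0 \<le> t"
  then show "disk_log_series a z + of_real t \<in> disk_log_series a ` \<bbbD>"
    unfolding disk_log_series_image disk_log_series_def
    by (intro log_series_translation cayley_in_half_plane)
qed

lemma disk_log_series_Re_at_1:
  "filterlim (\<lambda>z. Re (disk_log_series a z)) at_bot (at 1 within \<bbbD>)"
  unfolding disk_log_series_def by (rule filterlim_compose[OF log_series_Re_at_0 cayley_filterlim])

text \<open>
  The boundary point \<open>1\<close> is the only one at which the real part of the series is unbounded below.
\<close>

lemma tendsto_1_if_Re_at_bot:
  assumes inD: "\<forall>\<^sub>F x in F. f x \<in> \<bbbD>"
    and lim: "filterlim (\<lambda>x. Re (disk_log_series a (f x))) at_bot F"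
  shows "(f \<longlongrightarrow> 1) F"
proof (rule tendstoI)
  fix e :: real assume e: "0 < e"
  obtain B where B: "\<And>w. 0 \<le> Re w \<Longrightarrow> e / 2 \<le> cmod w \<Longrightarrow> B \<le> Re (log_series a w)"
    using log_series_Re_bounded_below[of "e / 2"] e by auto
  have "\<forall>\<^sub>F x in F. Re (disk_log_series a (f x)) < B"
    using lim by (simp add: filterlim_at_bot_dense)
  then show "\<forall>\<^sub>F x in F. dist (f x) 1 < e" using inD
  proof eventually_elim
    case (elim x)
    define w where "w = cayley (f x)"
    have w: "0 < Re w" using elim cayley_in_half_plane by (simp add: w_def)
    have "cmod w < e / 2"
      using B[of w] elim w by (force simp: disk_log_series_def w_def)
    have "cmod (1 - f x) = cmod w * cmod (1 + f x)"
      using one_minus_eq_cayley[OF elim(2)] by (simp add: w_def norm_mult)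
    also have "\<dots> \<le> cmod w * 2"
      using elim(2) norm_triangle_ineq[of 1 "f x"] by (intro mult_left_mono) auto
    also have "\<dots> < e" using \<open>cmod w < e / 2\<close> by simp
    finally show ?case by (simp add: dist_norm norm_minus_commute)
  qed
qed

lemma translation_semigroup_at_1:
  assumes "0 \<le> t"
  shows "(translation_semigroup (disk_log_series a) t \<longlongrightarrow> 1) (at 1 within \<bbbD>)"
proof (rule tendsto_1_if_Re_at_bot)
  have D: "\<forall>\<^sub>F z in at 1 within \<bbbD>. z \<in> \<bbbD>" by (simp add: eventually_at_filter)
  then show "\<forall>\<^sub>F z in at 1 within \<bbbD>. translation_semigroup (disk_log_series a) t z \<in> \<bbbD>"
    by (rule eventually_mono) (rule semigroup_in_disk[OF _ assms])
  have "filterlim (\<lambda>z. Re (disk_log_series a z) + t) at_bot (at 1 within \<bbbD>)"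
    using disk_log_series_Re_at_1 unfolding filterlim_at_bot_dense
    by (metis (no_types, lifting) eventually_mono less_diff_eq)
  moreover have "\<forall>\<^sub>F z in at 1 within \<bbbD>. Re (disk_log_series a z) + t =
      Re (disk_log_series a (translation_semigroup (disk_log_series a) t z))"
    using D by (rule eventually_mono) (simp add: koenigs_equation assms del: mem_ball)
  ultimately show "filterlim (\<lambda>z. Re (disk_log_series a (translation_semigroup (disk_log_series a) t z)))
      at_bot (at 1 within \<bbbD>)"
    by (rule filterlim_cong[OF refl refl, THEN iffD1, rotated])
qed

lemma at_stolz_le: "at w within stolz_region w M \<le> at w within \<bbbD>"
  by (rule at_le) (auto simp: stolz_region_def)

text \<open>
  With \<open>w\<close> and \<open>u\<close> the half-plane coordinates of \<open>z\<close> and its image, the quotient in question is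
  \<open>u / w\<close> up to a factor that is bounded away from \<open>0\<close> near \<open>1\<close>.
\<close>

lemma super_repulsive_at_1: "semigroup_super_repulsive (translation_semigroup (disk_log_series a)) 1"
  unfolding semigroup_super_repulsive_def super_repulsive_def boundary_fixed_point_def angular_lim_def
proof (intro allI impI conjI)
  fix t :: real assume t: "0 < t"
  let ?\<phi> = "translation_semigroup (disk_log_series a) t"
  show "(1::complex) \<in> sphere 0 1" by simp
  fix M :: real assume M: "1 < M"
  show "(?\<phi> \<longlongrightarrow> 1) (at 1 within stolz_region 1 M)"
    by (rule tendsto_mono[OF at_stolz_le translation_semigroup_at_1]) (use t in simp)
  show "filterlim (\<lambda>z. (1 - ?\<phi> z) / (1 - z)) at_infinity (at 1 within stolz_region 1 M)"
    unfolding filterlim_at_infinity[OF order_refl]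
  proof (intro allI impI)
    fix r :: real assume r: "0 < r"
    \<comment> \<open>The factor mentioned above has modulus at least \<open>1 / 2\<close>, hence the ratio \<open>2 * r\<close>.\<close>
    obtain \<rho> where \<rho>: "0 < \<rho>"
      "\<And>w u. 0 < cmod w \<Longrightarrow> cmod w < \<rho> \<Longrightarrow> 1 / (2 * M) * cmod w \<le> Re w \<Longrightarrow> Re w \<le> Re u \<Longrightarrow>
        cmod u \<le> 2 * r * cmod w \<Longrightarrow> cmod (log_series a u - log_series a w) < t"
      using log_series_increment_small[of "1 / (2 * M)" "2 * r" t] M r t by auto
    have "\<forall>\<^sub>F z in at 1 within stolz_region 1 M. cmod (cayley z) < \<rho>"
      using tendstoD[OF tendsto_mono[OF at_stolz_le cayley_tendsto_0] \<rho>(1)] by simp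
    moreover have "\<forall>\<^sub>F z in at 1 within stolz_region 1 M. dist (?\<phi> z) 1 < 1"
      using t by (intro tendstoD tendsto_mono[OF at_stolz_le translation_semigroup_at_1]) auto
    moreover have "\<forall>\<^sub>F z in at 1 within stolz_region 1 M. z \<in> stolz_region 1 M"
      by (simp add: eventually_at_filter)
    ultimately show "\<forall>\<^sub>F z in at 1 within stolz_region 1 M. r \<le> cmod ((1 - ?\<phi> z) / (1 - z))"
    proof eventually_elim
      case (elim z)
      have z: "z \<in> \<bbbD>" using elim by (simp add: stolz_region_def)
      have p: "?\<phi> z \<in> \<bbbD>" using semigroup_in_disk[OF z] t by simp
      define w where "w = cayley z"
      define u where "u = cayley (?\<phi> z)"
      have w: "0 < Re w" and u: "0 < Re u"
        unfolding w_def u_def by (intro cayley_in_half_plane z p)+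
      have wnz: "0 < cmod w" using w by auto
      have eq: "log_series a u = log_series a w + of_real t"
        using koenigs_equation[OF z, of t] t by (simp add: disk_log_series_def u_def w_def)
      have "Re w \<le> Re u" using Re_mono_along_translation[OF w u eq] t by simp
      moreover have "1 / (2 * M) * cmod w \<le> Re w"
        unfolding w_def using elim M by (intro Re_cayley_stolz) auto
      moreover have "\<not> cmod (log_series a u - log_series a w) < t" using eq t by simp
      ultimately have ratio: "2 * r * cmod w < cmod u"
        using \<rho>(2)[of w u] wnz elim(1) unfolding w_def[symmetric] by force
      have lo: "1 \<le> cmod (1 + ?\<phi> z)"
        using elim(2) norm_triangle_ineq4[of 2 "1 - ?\<phi> z"] norm_triangle_ineq2[of 2 "1 - ?\<phi> z"]
        by (simp add: dist_norm norm_minus_commute algebra_simps)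
      have hi: "0 < cmod (1 + z)" "cmod (1 + z) \<le> 2"
        using disk_one_plus_nonzero[OF z] norm_triangle_ineq[of 1 z] z by auto
      have "r * (cmod w * cmod (1 + z)) \<le> r * (cmod w * 2)"
        using r hi by (intro mult_left_mono) auto
      also have "\<dots> \<le> cmod u * 1" using ratio by simp
      also have "\<dots> \<le> cmod u * cmod (1 + ?\<phi> z)" using lo by (intro mult_left_mono) auto
      finally have "r \<le> cmod u * cmod (1 + ?\<phi> z) / (cmod w * cmod (1 + z))"
        using wnz hi by (simp add: pos_le_divide_eq)
      then show ?case
        unfolding one_minus_eq_cayley[OF z] one_minus_eq_cayley[OF p] u_def[symmetric] w_def[symmetric]
        by (simp add: norm_divide norm_mult)
    qed
  qed
qed

section \<open>The trajectory over the real line\<close>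

definition real_trajectory :: "real \<Rightarrow> complex"
  where "real_trajectory t = inv_into \<bbbD> (disk_log_series a) (of_real t)"

lemma real_line_in_disk_image: "of_real t \<in> disk_log_series a ` \<bbbD>"
  unfolding disk_log_series_image by (rule real_line_in_image)

lemma real_trajectory_in_disk: "real_trajectory t \<in> \<bbbD>"
  unfolding real_trajectory_def by (rule inv_into_into[OF real_line_in_disk_image])

lemma disk_log_series_real_trajectory: "disk_log_series a (real_trajectory t) = of_real t"
  unfolding real_trajectory_def by (rule f_inv_into_f[OF real_line_in_disk_image])

definition base_point :: complex
  where "base_point = real_trajectory 0"

lemma base_point_in_disk: "base_point \<in> \<bbbD>"
  unfolding base_point_def by (rule real_trajectory_in_disk)

lemma disk_log_series_base_point: "disk_log_series a base_point = 0"
  by (simp add: base_point_def disk_log_series_real_trajectory)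

lemma extended_trajectory_base_point:
  "extended_trajectory (disk_log_series a) base_point = real_trajectory"
  by (simp add: extended_trajectory_def[abs_def] real_trajectory_def[abs_def] disk_log_series_base_point)

lemma trajectory_start_base_point: "trajectory_start (disk_log_series a) base_point = - \<infinity>"
proof -
  have "Inf (range ereal) = - \<infinity>"
    by (rule ereal_bot) (rule Inf_lower, simp)
  then show ?thesis
    using real_line_in_disk_image by (simp add: trajectory_start_def disk_log_series_base_point)
qed

lemma real_trajectory_continuous: "continuous_on UNIV real_trajectory"
  unfolding real_trajectory_def[abs_def]
  by (rule continuous_on_compose2[OF holomorphic_on_imp_continuous_on[OF
          inv_into_holomorphic[OF hol open_ball inj]]])
     (auto intro!: continuous_intros real_line_in_disk_image simp del: mem_ball)

lemma real_trajectory_at_bot: "(real_trajectory \<longlongrightarrow> 1) at_bot"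
proof (rule tendsto_1_if_Re_at_bot)
  show "\<forall>\<^sub>F t in at_bot. real_trajectory t \<in> \<bbbD>"
    by (rule always_eventually) (rule allI, rule real_trajectory_in_disk)
  show "filterlim (\<lambda>t. Re (disk_log_series a (real_trajectory t))) at_bot at_bot"
    by (simp add: disk_log_series_real_trajectory filterlim_ident)
qed

definition half_plane_trajectory :: "real \<Rightarrow> complex"
  where "half_plane_trajectory t = cayley (real_trajectory t)"

lemma half_plane_trajectory_Re: "0 < Re (half_plane_trajectory t)"
  unfolding half_plane_trajectory_def by (rule cayley_in_half_plane[OF real_trajectory_in_disk])

lemma Im_log_series_half_plane_trajectory: "Im (log_series a (half_plane_trajectory t)) = 0"
  using disk_log_series_real_trajectory[of t] by (simp add: disk_log_series_def half_plane_trajectory_def)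

lemma half_plane_trajectory_continuous: "continuous_on UNIV half_plane_trajectory"
  unfolding half_plane_trajectory_def[abs_def]
  by (rule continuous_on_compose2[OF holomorphic_on_imp_continuous_on[OF cayley_holomorphic]
        real_trajectory_continuous]) (use real_trajectory_in_disk in auto)

lemma half_plane_trajectory_at_bot: "(half_plane_trajectory \<longlongrightarrow> 0) at_bot"
proof -
  have "(half_plane_trajectory \<longlongrightarrow> (1 - 1) / (1 + 1)) at_bot"
    unfolding half_plane_trajectory_def[abs_def] cayley_def
    by (intro tendsto_intros real_trajectory_at_bot) auto
  then show ?thesis by simp
qed

text \<open>
  The Cayley transform is not affine, but the angle it adds on the way to \<open>1\<close> vanishes in the
  limit.
\<close>

lemma Arg_disk_trajectory:
  "((\<lambda>t. Arg (1 - real_trajectory t) - Arg (half_plane_trajectory t)) \<longlongrightarrow> 0) at_bot"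
proof -
  have "((\<lambda>t. 1 + real_trajectory t) \<longlongrightarrow> 1 + 1) at_bot"
    by (intro tendsto_intros real_trajectory_at_bot)
  moreover have "isCont Arg (1 + 1)"
    by (rule continuous_at_Arg) (rule half_plane_not_nonpos, simp)
  ultimately have "((\<lambda>t. Arg (1 + real_trajectory t)) \<longlongrightarrow> Arg (1 + 1)) at_bot"
    by (rule isCont_tendsto_compose[rotated])
  then have "((\<lambda>t. Arg (1 + real_trajectory t)) \<longlongrightarrow> 0) at_bot"
    using Arg_of_real[of 2] by simp
  moreover have "Arg (1 - real_trajectory t) - Arg (half_plane_trajectory t) = Arg (1 + real_trajectory t)" for t
  proof -
    note b = Arg_bound_half_plane[OF half_plane_trajectory_Re[of t]]
      Arg_bound_half_plane[OF disk_one_plus_Re[OF real_trajectory_in_disk[of t]]]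
    have "half_plane_trajectory t \<noteq> 0" using half_plane_trajectory_Re[of t] by auto
    moreover have "Arg (half_plane_trajectory t) + Arg (1 + real_trajectory t) \<in> {- pi<..pi}"
      unfolding greaterThanAtMost_iff using b by linarith
    ultimately show ?thesis
      using one_minus_eq_cayley[OF real_trajectory_in_disk[of t]]
        disk_one_plus_nonzero[OF real_trajectory_in_disk[of t]]
      by (simp add: half_plane_trajectory_def Arg_times)
  qed
  ultimately show ?thesis by simp
qed

text \<open>
  Near the origin the imaginary part is positive above the direction \<open>b + \<delta>\<close>, and the
  trajectory has to stay below.
\<close>

lemma Arg_trajectory_less:
  assumes b: "\<And>k. k \<ge> k0 \<Longrightarrow> a k \<le> b" and "0 < \<delta>"
  shows "\<forall>\<^sub>F t in at_bot. Arg (half_plane_trajectory t) < b + \<delta>"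
proof -
  obtain \<rho> where \<rho>: "0 < \<rho>"
    "\<And>w. 0 < Re w \<Longrightarrow> cmod w < \<rho> \<Longrightarrow> b + \<delta> \<le> Arg w \<Longrightarrow> 0 < Im (log_series a w)"
    using Im_log_series_pos_near_0[of k0 b \<delta>] assms by blast
  have "\<forall>\<^sub>F t in at_bot. cmod (half_plane_trajectory t) < \<rho>"
    using tendstoD[OF half_plane_trajectory_at_bot \<rho>(1)] by simp
  then show ?thesis
  proof (rule eventually_mono)
    fix t assume "cmod (half_plane_trajectory t) < \<rho>"
    then have "\<not> b + \<delta> \<le> Arg (half_plane_trajectory t)"
      using \<rho>(2)[OF half_plane_trajectory_Re[of t]] Im_log_series_half_plane_trajectory[of t]
      by linarith
    then show "Arg (half_plane_trajectory t) < b + \<delta>" by simp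
  qed
qed

lemma Arg_cnj_half_plane: "0 < Re w \<Longrightarrow> Arg (cnj w) = - Arg w"
  by (simp add: Arg_cnj Arg_eq_0 complex_is_Real_iff)

lemma Arg_trajectory_greater:
  assumes b: "\<And>k. k \<ge> k0 \<Longrightarrow> b \<le> a k" and "0 < \<delta>"
  shows "\<forall>\<^sub>F t in at_bot. b - \<delta> < Arg (half_plane_trajectory t)"
proof -
  interpret neg: acute_angles "\<lambda>k. - a k" by (rule acute_angles_uminus)
  obtain \<rho> where \<rho>: "0 < \<rho>"
    "\<And>w. 0 < Re w \<Longrightarrow> cmod w < \<rho> \<Longrightarrow> - b + \<delta> \<le> Arg w \<Longrightarrow> 0 < Im (log_series (\<lambda>k. - a k) w)"
    using neg.Im_log_series_pos_near_0[of k0 "- b" \<delta>] assms by auto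
  have "\<forall>\<^sub>F t in at_bot. cmod (half_plane_trajectory t) < \<rho>"
    using tendstoD[OF half_plane_trajectory_at_bot \<rho>(1)] by simp
  then show ?thesis
  proof (rule eventually_mono)
    fix t assume t: "cmod (half_plane_trajectory t) < \<rho>"
    let ?w = "half_plane_trajectory t"
    have w: "0 < Re ?w" by (rule half_plane_trajectory_Re)
    have "?w \<in> punctured_closed_half_plane" using w by auto
    then have "Im (log_series (\<lambda>k. - a k) (cnj ?w)) = 0"
      using Im_log_series_half_plane_trajectory[of t] by (simp add: log_series_cnj)
    then have "\<not> - b + \<delta> \<le> Arg (cnj ?w)" using \<rho>(2)[of "cnj ?w"] t w by auto
    then show "b - \<delta> < Arg ?w" using Arg_cnj_half_plane[OF w] by simp
  qed
qed

text \<open>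
  The modulus of the trajectory takes every small value, in particular all but finitely many of
  the radii, and at \<open>radius n\<close> the signs of the imaginary part force the argument to be near \<open>a n\<close>.
\<close>

lemma Arg_trajectory_on_circles:
  assumes \<delta>: "0 < \<delta>"
  shows "\<forall>\<^sub>F n in sequentially. \<exists>t<T. \<bar>Arg (half_plane_trajectory t) - a n\<bar> < \<delta>"
proof -
  interpret neg: acute_angles "\<lambda>k. - a k" by (rule acute_angles_uminus)
  let ?w = half_plane_trajectory
  have "0 < cmod (?w (T - 1))" using half_plane_trajectory_Re[of "T - 1"] by auto
  then have "\<forall>\<^sub>F n in sequentially. radius n < cmod (?w (T - 1))"
    by (rule order_tendstoD(2)[OF radius_tendsto_0])
  with Im_log_series_pos_on_circle[OF \<delta>] neg.Im_log_series_pos_on_circle[OF \<delta>]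
  show ?thesis
  proof eventually_elim
    case (elim n)
    have "\<forall>\<^sub>F t in at_bot. cmod (?w t) < radius n"
      using tendstoD[OF half_plane_trajectory_at_bot radius_pos[of n]] by simp
    then obtain s where s: "cmod (?w s) < radius n" "s < T"
      using eventually_happens[OF eventually_conj[OF _ eventually_gt_at_bot[of T]]]
      by (metis (mono_tags, lifting) trivial_limit_at_bot_linorder)
    have "connected ((\<lambda>t. cmod (?w t)) ` {..<T})"
      by (intro connected_continuous_image continuous_on_norm
          continuous_on_subset[OF half_plane_trajectory_continuous]) auto
    then have "{cmod (?w s)..cmod (?w (T - 1))} \<subseteq> (\<lambda>t. cmod (?w t)) ` {..<T}"
      using s(2) by (intro connected_contains_Icc) auto
    moreover have "radius n \<in> {cmod (?w s)..cmod (?w (T - 1))}" using s elim(3) by simp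
    ultimately have "radius n \<in> (\<lambda>t. cmod (?w t)) ` {..<T}" by (rule subsetD)
    then obtain t where t: "t < T" "cmod (?w t) = radius n" by auto
    have w: "0 < Re (?w t)" by (rule half_plane_trajectory_Re)
    note im = Im_log_series_half_plane_trajectory[of t]
    have "Arg (?w t) < a n + \<delta>" using elim(1) w t im by (metis less_irrefl not_le)
    moreover have "?w t \<in> punctured_closed_half_plane" using w by auto
    then have "Im (log_series (\<lambda>k. - a k) (cnj (?w t))) = 0" using im by (simp add: log_series_cnj)
    then have "Arg (cnj (?w t)) < - a n + \<delta>"
      using elim(2) w t by (metis cnj.simps(1) complex_mod_cnj less_irrefl not_le)
    ultimately have "\<bar>Arg (?w t) - a n\<bar> < \<delta>" using Arg_cnj_half_plane[OF w] by auto
    then show ?case using t(1) by blast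
  qed
qed

text \<open>
  The slope set is the interval spanned by the lower and the upper limit of the angles, as the
  trajectory follows the angle \<open>a n\<close> at the radius with number \<open>n\<close>.
\<close>

lemma slope_minus_eq:
  assumes "l \<le> u"
    and ev: "\<And>e. 0 < e \<Longrightarrow> \<forall>\<^sub>F k in sequentially. l - e \<le> a k \<and> a k \<le> u + e"
    and lo: "\<And>e. 0 < e \<Longrightarrow> \<exists>\<^sub>F k in sequentially. a k < l + e"
    and hi: "\<And>e. 0 < e \<Longrightarrow> \<exists>\<^sub>F k in sequentially. u - e < a k"
  shows "slope_minus (disk_log_series a) base_point 1 = {l..u}"
proof -
  let ?f = "\<lambda>t. Arg (1 - real_trajectory t)" and ?g = "\<lambda>t. Arg (half_plane_trajectory t)"
  have close: "\<forall>\<^sub>F t in at_bot. \<bar>?f t - ?g t\<bar> < e" if "0 < e" for e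
    using tendstoD[OF Arg_disk_trajectory that] by simp
  have freq: "\<exists>\<^sub>F t in at_bot. \<bar>?f t - x\<bar> < e"
    if x: "\<And>e. 0 < e \<Longrightarrow> \<exists>\<^sub>F k in sequentially. \<bar>a k - x\<bar> < e" and e: "0 < e" for x e
    unfolding frequently_def eventually_at_bot_dense not_not
  proof
    assume "\<exists>N. \<forall>t<N. \<not> \<bar>?f t - x\<bar> < e"
    then obtain N where N: "\<And>t. t < N \<Longrightarrow> \<not> \<bar>?f t - x\<bar> < e" by blast
    obtain N' where N': "\<And>t. t < N' \<Longrightarrow> \<bar>?f t - ?g t\<bar> < e / 3"
      using close[of "e / 3"] e unfolding eventually_at_bot_dense by auto
    have "\<exists>\<^sub>F k in sequentially. \<bar>a k - x\<bar> < e / 3 \<and> (\<exists>t<min N N'. \<bar>?g t - a k\<bar> < e / 3)"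
      using x[of "e / 3"] Arg_trajectory_on_circles[of "e / 3" "min N N'"] e
      by (intro frequently_eventually_frequently) auto
    then obtain k t where "\<bar>a k - x\<bar> < e / 3" "t < N" "t < N'" "\<bar>?g t - a k\<bar> < e / 3"
      using frequently_ex by fastforce
    with N[of t] N'[of t] show False by linarith
  qed
  have "alpha_limit_set (- \<infinity>) \<infinity> ?f = {l..u}"
  proof (rule alpha_limit_set_eq_Icc[OF _ assms(1)])
    have "Re (1 - real_trajectory t) > 0" for t
      using real_trajectory_in_disk[of t] abs_Re_le_cmod[of "real_trajectory t"] by simp
    then have np: "1 - real_trajectory t \<notin> \<real>\<^sub>\<le>\<^sub>0" for t by (rule half_plane_not_nonpos)
    show "continuous_on UNIV ?f"
      by (intro continuous_intros real_trajectory_continuous np)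
    fix e :: real assume e: "0 < e"
    obtain k0 where k0: "\<And>k. k0 \<le> k \<Longrightarrow> l - e / 3 \<le> a k \<and> a k \<le> u + e / 3"
      using ev[of "e / 3"] e unfolding eventually_sequentially by auto
    have "\<forall>\<^sub>F t in at_bot. ?g t < (u + e / 3) + e / 3"
      using k0 e by (intro Arg_trajectory_less[of k0]) auto
    moreover have "\<forall>\<^sub>F t in at_bot. (l - e / 3) - e / 3 < ?g t"
      using k0 e by (intro Arg_trajectory_greater[of k0]) auto
    moreover have "\<forall>\<^sub>F t in at_bot. \<bar>?f t - ?g t\<bar> < e / 3" using e by (intro close) simp
    ultimately show "\<forall>\<^sub>F t in at_bot. l - e < ?f t \<and> ?f t < u + e"
      by eventually_elim linarith
    have al: "\<exists>\<^sub>F k in sequentially. \<bar>a k - l\<bar> < e" if "0 < e" for e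
    proof -
      have "\<forall>\<^sub>F k in sequentially. l - e / 2 \<le> a k" using ev[of "e / 2"] that by (auto elim: eventually_mono)
      from frequently_eventually_frequently[OF lo[OF that] this] show ?thesis
        using that by (auto elim!: frequently_elim1)
    qed
    have au: "\<exists>\<^sub>F k in sequentially. \<bar>a k - u\<bar> < e" if "0 < e" for e
    proof -
      have "\<forall>\<^sub>F k in sequentially. a k \<le> u + e / 2" using ev[of "e / 2"] that by (auto elim: eventually_mono)
      from frequently_eventually_frequently[OF hi[OF that] this] show ?thesis
        using that by (auto elim!: frequently_elim1)
    qed
    show "\<exists>\<^sub>F t in at_bot. ?f t < l + e"
      using freq[OF al e] by (auto elim!: frequently_elim1)
    show "\<exists>\<^sub>F t in at_bot. u - e < ?f t"
      using freq[OF au e] by (auto elim!: frequently_elim1)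
  qed
  then show ?thesis
    by (simp add: slope_minus_def trajectory_start_base_point extended_trajectory_base_point)
qed

lemma trajectory_alpha_limit_set_base_point:
  "trajectory_alpha_limit_set (disk_log_series a) base_point = {1}"
  unfolding trajectory_alpha_limit_set_def trajectory_start_base_point extended_trajectory_base_point
  by (rule alpha_limit_set_tendsto[OF real_trajectory_at_bot])

end

section \<open>Prescribed slopes\<close>

text \<open>
  The factor keeps the angles strictly between \<open>- pi / 2\<close> and \<open>pi / 2\<close>, also when the prescribed
  slopes are extreme, and it tends to \<open>1\<close>.
\<close>

definition alternating_angle :: "real \<Rightarrow> real \<Rightarrow> nat \<Rightarrow> real"
  where "alternating_angle x y k = (if even k then x else y) * (1 - 1 / (real k + 2))"

lemma alternating_angle_acute:
  assumes "\<bar>x\<bar> \<le> pi / 2" "\<bar>y\<bar> \<le> pi / 2"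
  shows "\<bar>alternating_angle x y k\<bar> < pi / 2"
proof -
  have c: "0 < 1 - 1 / (real k + 2)" "1 - 1 / (real k + 2) < 1" by (simp_all add: field_simps)
  have "\<bar>alternating_angle x y k\<bar> = \<bar>if even k then x else y\<bar> * (1 - 1 / (real k + 2))"
    using c by (simp add: alternating_angle_def abs_mult)
  also have "\<dots> \<le> pi / 2 * (1 - 1 / (real k + 2))" using assms c by (intro mult_right_mono) auto
  also have "\<dots> < pi / 2 * 1" using c by (intro mult_strict_left_mono) auto
  finally show ?thesis by simp
qed

lemma alternating_angle_close:
  assumes "0 < e"
  shows "\<forall>\<^sub>F k in sequentially. \<bar>alternating_angle x y k - (if even k then x else y)\<bar> < e"
proof -
  have "(\<lambda>k. (\<bar>x\<bar> + \<bar>y\<bar>) / (real k + 2)) \<longlonglongrightarrow> 0" by real_asymp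
  then have "\<forall>\<^sub>F k in sequentially. (\<bar>x\<bar> + \<bar>y\<bar>) / (real k + 2) < e"
    using assms by (rule order_tendstoD(2))
  then show ?thesis
  proof (rule eventually_mono)
    fix k assume k: "(\<bar>x\<bar> + \<bar>y\<bar>) / (real k + 2) < e"
    let ?v = "if even k then x else y"
    have "alternating_angle x y k - ?v = - (?v / (real k + 2))"
      by (simp add: alternating_angle_def algebra_simps)
    then have "\<bar>alternating_angle x y k - ?v\<bar> = \<bar>?v\<bar> / (real k + 2)" by simp
    also have "\<dots> \<le> (\<bar>x\<bar> + \<bar>y\<bar>) / (real k + 2)" by (intro divide_right_mono) auto
    finally show "\<bar>alternating_angle x y k - ?v\<bar> < e" using k by linarith
  qed
qed

lemma frequently_even: "\<exists>\<^sub>F k in sequentially. even (k::nat)"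
  unfolding frequently_sequentially by (metis even_add le_add1)

lemma frequently_odd: "\<exists>\<^sub>F k in sequentially. odd (k::nat)"
  unfolding frequently_sequentially by (metis even_add le_add1 odd_one add_Suc_right even_Suc le_SucI)

theorem theorem2:
  fixes \<theta>1 \<theta>2 :: real
  assumes "\<theta>1 \<le> \<theta>2" and "\<bar>\<theta>1\<bar> \<le> pi / 2" and "\<bar>\<theta>2\<bar> \<le> pi / 2"
  shows "\<exists>\<phi> h z \<sigma>.
    holomorphic_semigroup \<phi> \<and> non_elliptic \<phi> \<and> koenigs_function \<phi> h \<and> z \<in> \<bbbD> \<and>
    trajectory_alpha_limit_set h z = {\<sigma>} \<and>
    semigroup_super_repulsive \<phi> \<sigma> \<and>
    slope_minus h z \<sigma> = {\<theta>1..\<theta>2}"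
proof -
  interpret acute_angles "alternating_angle \<theta>1 \<theta>2"
    by unfold_locales (rule alternating_angle_acute[OF assms(2,3)])
  note close = alternating_angle_close[where x = \<theta>1 and y = \<theta>2]
  have "slope_minus (disk_log_series (alternating_angle \<theta>1 \<theta>2)) base_point 1 = {\<theta>1..\<theta>2}"
  proof (rule slope_minus_eq[OF assms(1)])
    fix e :: real assume e: "0 < e"
    show "\<forall>\<^sub>F k in sequentially. \<theta>1 - e \<le> alternating_angle \<theta>1 \<theta>2 k \<and> alternating_angle \<theta>1 \<theta>2 k \<le> \<theta>2 + e"
      using close[OF e] by (rule eventually_mono) (use assms(1) in \<open>auto split: if_splits\<close>)
    show "\<exists>\<^sub>F k in sequentially. alternating_angle \<theta>1 \<theta>2 k < \<theta>1 + e"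
      using frequently_eventually_frequently[OF frequently_even close[OF e]]
      by (rule frequently_elim1) auto
    show "\<exists>\<^sub>F k in sequentially. \<theta>2 - e < alternating_angle \<theta>1 \<theta>2 k"
      using frequently_eventually_frequently[OF frequently_odd close[OF e]]
      by (rule frequently_elim1) auto
  qed
  then show ?thesis
    using holomorphic_semigroup non_elliptic koenigs_function base_point_in_disk
      trajectory_alpha_limit_set_base_point super_repulsive_at_1 by blast
qed

end
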